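(* Let $\mathfrak{g}=\mathfrak{gl}(m|n)$ and let $V$ be an irreducible unitary $(\mathfrak{g},\mathfrak{g}_0)$-module. Regard $D$, $d$ and $\delta$ as operators on $V\otimes M(\mathfrak{g}_1)$. Then (i) $V\otimes M(\mathfrak{g}_1)=\mathrm{Ker}\,D\oplus\mathrm{Im}\,d\oplus\mathrm{Im}\,\delta$; (ii) $\mathrm{Ker}\,d=\mathrm{Ker}\,D\oplus\mathrm{Im}\,d$; (iii) $\mathrm{Ker}\,\delta=\mathrm{Ker}\,D\oplus\mathrm{Im}\,\delta$. In particular, there exist $\mathfrak{g}_0$-module isomorphisms $$H_D(V)\simeq H^*(\mathfrak{g}_+,V)\otimes\mathbb{C}_{-\rho_1}\simeq H_*(\mathfrak{g}_-,V)\otimes\mathbb{C}_{-\rho_1}.$$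
   Context: Setting. $\mathfrak{g}=\mathfrak{gl}(m|n)$ is the complex general linear Lie superalgebra, $E_{ij}$ ($1\le i,j\le m+n$) its matrix units, $[\cdot,\cdot]$ its superbracket. Even part: $\mathfrak{g}_0=\sum_{i,j\le m}\mathbb{C}E_{ij}+\sum_{k,l>m}\mathbb{C}E_{kl}$; Cartan subalgebra $\mathfrak{h}_0=\sum_i\mathbb{C}E_{ii}$. Odd part: $\mathfrak{g}_1=\mathfrak{g}_+\oplus\mathfrak{g}_-$ with $\mathfrak{g}_+=\sum_{i\le m<k}\mathbb{C}E_{ik}$, $\mathfrak{g}_-=\sum_{i\le m<k}\mathbb{C}E_{ki}$ (both $\mathfrak{g}_0$-invariant and supercommutative). $\Delta_1^+$ is the set of weights of $\mathfrak{h}_0$ on $\mathfrak{g}_+$ and $\rho_1=\frac12\sum_{\beta\in\Delta_1^+}\beta$; $\mathbb{C}_{-\rho_1}$ is the one-dimensional $\mathfrak{g}_0$-module of weight $-\rho_1$. Form and bases. $B(X,Y)=\frac12\mathrm{str}(XY)$, with $\mathrm{str}A=\sum_{i\le m}a_{ii}-\sum_{j>m}a_{jj}$. For $i\le m<k$ put $\partial_{(i-1)n+(k-m)}=E_{ik}$ and $x_{(i-1)n+(k-m)}=E_{ki}$; these are bases of $\mathfrak{g}_+$ and $\mathfrak{g}_-$, and $B(\partial_i,x_j)=\frac12\delta_{ij}$. Weyl algebra and Weil representation. $W(\mathfrak{g}_1)$ is the Weyl algebra generated by the $\partial_i,x_i$ ($1\le i\le mn$) with commutation relations $[x_i,x_j]_W=0$,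 $[\partial_i,\partial_j]_W=0$, $[\partial_i,x_j]_W=\delta_{ij}$. $M(\mathfrak{g}_1)$ is the space $\mathbb{C}[x_1,\dots,x_{mn}]$ with $x_i\in W(\mathfrak{g}_1)$ acting by multiplication and $\partial_i$ by $\partial/\partial x_i$. The Lie algebra morphism $\alpha:\mathfrak{g}_0\to W(\mathfrak{g}_1)$ is $$\alpha(X)=-\sum_{i,j}2B(X,[x_i,\partial_j])\,x_j\partial_i-\sum_iB(X,[\partial_i,x_i]).$$ For a $\mathfrak{g}$-module $V$, $\mathfrak{g}_0$ acts on $V\otimes M(\mathfrak{g}_1)$ by $X\mapsto X\otimes1+1\otimes\alpha(X)$. Operators. In $U(\mathfrak{g})\otimes W(\mathfrak{g}_1)$ let $d=\sum_i\partial_i\otimes x_i$, $\delta=\sum_i x_i\otimes\partial_i$, and let the Dirac operator be $D=2\sum_i(\partial_i\otimes x_i-x_i\otimes\partial_i)=2(d-\delta)$; these act on $V\otimes M(\mathfrak{g}_1)$. The Dirac cohomology is the $\mathfrak{g}_0$-module $H_D(V)=\mathrm{Ker}\,D/(\mathrm{Ker}\,D\cap\mathrm{Im}\,D)$. Cohomology and homology. $\mathfrak{g}_+^*$ is identified with $\mathfrak{g}_-$ via the $\mathfrak{g}_0$-invariant pairing $2B(\cdot,\cdot)$, and $S(\mathfrak{g}_+^* )$ with $S(\mathfrak{g}_-)=\mathbb{C}[x_1,\dots,x_{mn}]$, on which $\mathfrak{g}_0$ acts by the natural (adjoint) action. $H^i(\mathfrak{g}_+,V)$ is the degree-$i$ cohomology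 of the complex $(\{V\otimes S^i(\mathfrak{g}_-)\},d)$ and $H_i(\mathfrak{g}_-,V)$ is the degree-$i$ homology of $(\{V\otimes S^i(\mathfrak{g}_-)\},\delta)$, with $d,\delta$ given by the formulas above; they are $\mathfrak{g}_0$-modules via the tensor product action on $V\otimes S(\mathfrak{g}_-)$. $H^*=\bigoplus_iH^i$ and $H_*=\bigoplus_iH_i$. Modules. A $(\mathfrak{g},\mathfrak{g}_0)$-module is a $\mathfrak{g}$-module which, as a $\mathfrak{g}_0$-module, is a direct sum of finite-dimensional simple modules with finite multiplicities. Let $\omega$ be the antilinear anti-involution of $U(\mathfrak{g})$ with $\omega(E_{ij})=E_{ji}$ and $\omega(ab)=\omega(b)\omega(a)$. A $\mathbb{Z}_2$-graded $\mathfrak{g}$-module $V$ is unitary if it admits a positive definite Hermitian form $\langle\cdot,\cdot\rangle_V$ with $\langle av,v'\rangle_V=\langle v,\omega(a)v'\rangle_V$ for all $a\in\mathfrak{g}$, $v,v'\in V$. *)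

theory Defs
  imports
    "HOL-Analysis.Analysis"
    "HOL-Library.Poly_Mapping"
    "HOL-Library.Set_Algebras"
    "HOL-Library.Z2"
begin

section \<open>The Lie superalgebra \<open>gl(m|n)\<close>\<close>

text \<open>
  The index set \<open>{1,...,m+n}\<close> is the disjoint sum of two finite types of sizes \<open>m\<close> and \<open>n\<close>:
  \<open>Inl i\<close> stands for an index \<open>i \<le> m\<close> and \<open>Inr k\<close> for an index \<open>k > m\<close>.
  \<open>\<int>\<^sub>2\<close> is the type \<^typ>\<open>bit\<close>.
\<close>

type_synonym ('m, 'n) gl = "complex ^ ('m + 'n) ^ ('m + 'n)"

definition mscale :: "complex \<Rightarrow> complex ^ 'r ^ 'r \<Rightarrow> complex ^ 'r ^ 'r" where
  "mscale c X = (\<chi> a b. c * X $ a $ b)"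

definition E :: "'r \<Rightarrow> 'r \<Rightarrow> complex ^ 'r ^ 'r" where
  "E i j = (\<chi> a b. if a = i \<and> b = j then 1 else 0)"

fun parity :: "'m + 'n \<Rightarrow> bit" where
  "parity (Inl i) = 0"
| "parity (Inr k) = 1"

definition gl_part :: "bit \<Rightarrow> ('m::finite, 'n::finite) gl set" where
  "gl_part p = {X. \<forall>a b. parity a + parity b \<noteq> p \<longrightarrow> X $ a $ b = 0}"

definition gl_component :: "bit \<Rightarrow> ('m::finite, 'n::finite) gl \<Rightarrow> ('m, 'n) gl" where
  "gl_component p X = (\<chi> a b. if parity a + parity b = p then X $ a $ b else 0)"

definition ksign :: "bit \<Rightarrow> bit \<Rightarrow> complex" where
  "ksign p q = (if p = 1 \<and> q = 1 then - 1 else 1)"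

definition sbracket :: "('m::finite, 'n::finite) gl \<Rightarrow> ('m, 'n) gl \<Rightarrow> ('m, 'n) gl" where
  "sbracket X Y = (\<Sum>p\<in>{0, 1}. \<Sum>q\<in>{0, 1}.
     gl_component p X ** gl_component q Y
     - mscale (ksign p q) (gl_component q Y ** gl_component p X))"

abbreviation g0 :: "('m::finite, 'n::finite) gl set" where
  "g0 \<equiv> gl_part 0"

definition h0 :: "('m::finite, 'n::finite) gl set" where
  "h0 = {X. \<forall>a b. a \<noteq> b \<longrightarrow> X $ a $ b = 0}"

definition gplus :: "('m::finite, 'n::finite) gl set" where
  "gplus = {X. \<forall>a b. \<not> (parity a = 0 \<and> parity b = 1) \<longrightarrow> X $ a $ b = 0}"

definition str :: "('m::finite, 'n::finite) gl \<Rightarrow> complex" where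
  "str A = (\<Sum>i\<in>UNIV. A $ Inl i $ Inl i) - (\<Sum>k\<in>UNIV. A $ Inr k $ Inr k)"

definition B :: "('m::finite, 'n::finite) gl \<Rightarrow> ('m, 'n) gl \<Rightarrow> complex" where
  "B X Y = str (X ** Y) / 2"

text \<open>
  The bases of \<open>\<gg>\<^sub>+\<close> and \<open>\<gg>\<^sub>-\<close> are indexed by pairs \<open>(i, k)\<close> rather than by the
  numbers \<open>(i - 1) n + (k - m)\<close> enumerating them.
\<close>

definition dd :: "'m \<times> 'n \<Rightarrow> ('m::finite, 'n::finite) gl" where
  "dd p = E (Inl (fst p)) (Inr (snd p))"

definition xx :: "'m \<times> 'n \<Rightarrow> ('m::finite, 'n::finite) gl" where
  "xx p = E (Inr (snd p)) (Inl (fst p))"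

text \<open>Weights are functions on \<^const>\<open>h0\<close>; outside \<^const>\<open>h0\<close> they are \<^const>\<open>undefined\<close>.\<close>

definition Delta1_plus :: "(('m::finite, 'n::finite) gl \<Rightarrow> complex) set" where
  "Delta1_plus = {\<beta> \<in> extensional h0.
     \<exists>Y\<in>gplus. Y \<noteq> 0 \<and> (\<forall>h\<in>h0. sbracket h Y = mscale (\<beta> h) Y)}"

definition rho1 :: "('m::finite, 'n::finite) gl \<Rightarrow> complex" where
  "rho1 h = (\<Sum>\<beta>\<in>Delta1_plus. \<beta> h) / 2"

definition diag_part :: "('m::finite, 'n::finite) gl \<Rightarrow> ('m, 'n) gl" where
  "diag_part X = (\<chi> a b. if a = b then X $ a $ b else 0)"

text \<open>
  The scalar by which \<open>X \<in> \<gg>\<^sub>0\<close> acts on the one-dimensional module \<open>\<complex>\<^bsub>-\<rho>\<^sub>1\<^esub>\<close>: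
  the root vectors \<open>E\<^sub>a\<^sub>b\<close>, \<open>a \<noteq> b\<close>, of \<open>\<gg>\<^sub>0\<close> are commutators and act by zero.
\<close>

definition chi_minus_rho1 :: "('m::finite, 'n::finite) gl \<Rightarrow> complex" where
  "chi_minus_rho1 X = - rho1 (diag_part X)"

text \<open>
  The restriction of \<open>\<omega>\<close> to \<open>gl(m|n)\<close>: the antilinear map with \<open>E\<^sub>i\<^sub>j \<mapsto> E\<^sub>j\<^sub>i\<close>.
\<close>

definition omega :: "('m::finite, 'n::finite) gl \<Rightarrow> ('m, 'n) gl" where
  "omega X = (\<chi> a b. cnj (X $ b $ a))"


section \<open>Direct sums and modules\<close>

definition ker :: "('a \<Rightarrow> 'b::zero) \<Rightarrow> 'a set" where
  "ker f = {x. f x = 0}"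

text \<open>\<open>U\<close> is the internal direct sum of the subspaces \<open>A i\<close>, \<open>i \<in> I\<close>.\<close>

definition is_direct_sum :: "'i set \<Rightarrow> ('i \<Rightarrow> 'a::comm_monoid_add set) \<Rightarrow> 'a set \<Rightarrow> bool" where
  "is_direct_sum I A U \<longleftrightarrow>
     bij_betw (\<lambda>f. \<Sum>i | f i \<noteq> 0. f i)
       {f. finite {i. f i \<noteq> 0} \<and> (\<forall>i\<in>I. f i \<in> A i) \<and> (\<forall>i. i \<notin> I \<longrightarrow> f i = 0)} U"

definition is_direct_sum_list :: "'a::comm_monoid_add set list \<Rightarrow> 'a set \<Rightarrow> bool" where
  "is_direct_sum_list As U \<longleftrightarrow> is_direct_sum {..<length As} (\<lambda>i. As ! i) U"

text \<open>
  Modules with explicit carrier and operations, for subquotients. Only the action of elements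
  of \<^const>\<open>g0\<close> is relevant.
\<close>

record ('x, 'a) lmod =
  lcarrier :: "'a set"
  lzero :: "'a"
  ladd :: "'a \<Rightarrow> 'a \<Rightarrow> 'a"
  lsmult :: "complex \<Rightarrow> 'a \<Rightarrow> 'a"
  lact :: "'x \<Rightarrow> 'a \<Rightarrow> 'a"

definition g0_isomorphic ::
  "(('m::finite, 'n::finite) gl, 'a) lmod \<Rightarrow> (('m, 'n) gl, 'b) lmod \<Rightarrow> bool" where
  "g0_isomorphic M N \<longleftrightarrow> (\<exists>\<phi>. bij_betw \<phi> (lcarrier M) (lcarrier N)
     \<and> (\<forall>a\<in>lcarrier M. \<forall>b\<in>lcarrier M. \<phi> (ladd M a b) = ladd N (\<phi> a) (\<phi> b))
     \<and> (\<forall>c. \<forall>a\<in>lcarrier M. \<phi> (lsmult M c a) = lsmult N c (\<phi> a))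
     \<and> (\<forall>X\<in>g0. \<forall>a\<in>lcarrier M. \<phi> (lact M X a) = lact N X (\<phi> a)))"

definition submod ::
  "(complex \<Rightarrow> 'a \<Rightarrow> 'a) \<Rightarrow> ('x \<Rightarrow> 'a \<Rightarrow> 'a) \<Rightarrow> 'a::ab_group_add set \<Rightarrow> ('x, 'a) lmod" where
  "submod sc act W =
     \<lparr>lcarrier = W, lzero = 0, ladd = (+), lsmult = sc, lact = act\<rparr>"

text \<open>
  The quotient \<open>K / L\<close>, with cosets \<open>a + L\<close> as elements. Adding \<open>L\<close> after applying an operation to
  all members of a coset gives the coset of the result, also where the operation is not onto.
\<close>

definition quotmod ::
  "(complex \<Rightarrow> 'a \<Rightarrow> 'a) \<Rightarrow> ('x \<Rightarrow> 'a \<Rightarrow> 'a) \<Rightarrow> 'a::ab_group_add set \<Rightarrow> 'a set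
    \<Rightarrow> ('x, 'a set) lmod" where
  "quotmod sc act K L =
     \<lparr>lcarrier = (\<lambda>a. a +o L) ` K, lzero = L, ladd = (+),
      lsmult = (\<lambda>c C. sc c ` C + L), lact = (\<lambda>X C. act X ` C + L)\<rparr>"

definition dsum_mod :: "(nat \<Rightarrow> ('x, 'a) lmod) \<Rightarrow> ('x, nat \<Rightarrow> 'a) lmod" where
  "dsum_mod M =
     \<lparr>lcarrier = {f. (\<forall>i. f i \<in> lcarrier (M i)) \<and> finite {i. f i \<noteq> lzero (M i)}},
      lzero = (\<lambda>i. lzero (M i)),
      ladd = (\<lambda>f g i. ladd (M i) (f i) (g i)),
      lsmult = (\<lambda>c f i. lsmult (M i) c (f i)),
      lact = (\<lambda>X f i. lact (M i) X (f i))\<rparr>"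

text \<open>
  The tensor product of \<open>M\<close> with the one-dimensional module \<open>\<complex>\<close> on which \<open>X\<close> acts by the scalar
  \<open>\<xi> X\<close>; the vector \<open>a \<otimes> 1\<close> is written \<open>a\<close>, so that \<open>X (a \<otimes> 1) = X a \<otimes> 1 + a \<otimes> \<xi> X\<close>.
\<close>

definition tensor_char :: "('x, 'a) lmod \<Rightarrow> ('x \<Rightarrow> complex) \<Rightarrow> ('x, 'a) lmod" where
  "tensor_char M \<xi> = M\<lparr>lact := (\<lambda>X a. ladd M (lact M X a) (lsmult M (\<xi> X) a))\<rparr>"


section \<open>Unitary \<open>(\<gg>, \<gg>\<^sub>0)\<close>-modules\<close>

text \<open>
  Throughout, \<open>sc\<close> is scalar multiplication on the space \<open>V\<close> (a whole type), \<open>Vgr 0\<close> and \<open>Vgr 1\<close>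
  are its even and odd parts and \<open>\<pi>\<close> is the action of \<open>gl(m|n)\<close>.
\<close>

definition gl_module ::
  "(complex \<Rightarrow> 'v::ab_group_add \<Rightarrow> 'v) \<Rightarrow> (bit \<Rightarrow> 'v set)
    \<Rightarrow> (('m::finite, 'n::finite) gl \<Rightarrow> 'v \<Rightarrow> 'v) \<Rightarrow> bool" where
  "gl_module sc Vgr \<pi> \<longleftrightarrow>
     vector_space sc
     \<and> (\<forall>p. module.subspace sc (Vgr p)) \<and> is_direct_sum UNIV Vgr UNIV
     \<and> (\<forall>X. Vector_Spaces.linear sc sc (\<pi> X))
     \<and> (\<forall>X Y v. \<pi> (X + Y) v = \<pi> X v + \<pi> Y v)
     \<and> (\<forall>c X v. \<pi> (mscale c X) v = sc c (\<pi> X v))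
     \<and> (\<forall>p q. \<forall>X\<in>gl_part p. \<forall>v\<in>Vgr q. \<pi> X v \<in> Vgr (p + q))
     \<and> (\<forall>p q. \<forall>X\<in>gl_part p. \<forall>Y\<in>gl_part q. \<forall>v.
          \<pi> (sbracket X Y) v = \<pi> X (\<pi> Y v) - sc (ksign p q) (\<pi> Y (\<pi> X v)))"

definition g0_submodule ::
  "(complex \<Rightarrow> 'v::ab_group_add \<Rightarrow> 'v) \<Rightarrow> (('m::finite, 'n::finite) gl \<Rightarrow> 'v \<Rightarrow> 'v)
    \<Rightarrow> 'v set \<Rightarrow> bool" where
  "g0_submodule sc \<pi> W \<longleftrightarrow> module.subspace sc W \<and> (\<forall>X\<in>g0. \<pi> X ` W \<subseteq> W)"

definition g0_simple ::
  "(complex \<Rightarrow> 'v::ab_group_add \<Rightarrow> 'v) \<Rightarrow> (('m::finite, 'n::finite) gl \<Rightarrow> 'v \<Rightarrow> 'v)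
    \<Rightarrow> 'v set \<Rightarrow> bool" where
  "g0_simple sc \<pi> W \<longleftrightarrow> g0_submodule sc \<pi> W \<and> W \<noteq> {0}
     \<and> (\<forall>U. g0_submodule sc \<pi> U \<and> U \<subseteq> W \<longrightarrow> U = {0} \<or> U = W)"

text \<open>
  \<open>V\<close> is the direct sum of a family of finite-dimensional simple \<open>\<gg>\<^sub>0\<close>-submodules, each isomorphism
  type occurring finitely often. The summands, being nonzero, are pairwise distinct, so that
  the family can be given as a set of subspaces.
\<close>

definition g_g0_module ::
  "(complex \<Rightarrow> 'v::ab_group_add \<Rightarrow> 'v) \<Rightarrow> (bit \<Rightarrow> 'v set)
    \<Rightarrow> (('m::finite, 'n::finite) gl \<Rightarrow> 'v \<Rightarrow> 'v) \<Rightarrow> bool" where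
  "g_g0_module sc Vgr \<pi> \<longleftrightarrow> gl_module sc Vgr \<pi>
     \<and> (\<exists>\<W> :: 'v set set.
          is_direct_sum \<W> (\<lambda>W. W) UNIV
          \<and> (\<forall>W\<in>\<W>. g0_simple sc \<pi> W \<and> (\<exists>S. finite S \<and> module.span sc S = W))
          \<and> (\<forall>W\<in>\<W>. finite {W'\<in>\<W>. g0_isomorphic (submod sc \<pi> W) (submod sc \<pi> W')}))"

definition irreducible_module ::
  "(complex \<Rightarrow> 'v::ab_group_add \<Rightarrow> 'v) \<Rightarrow> (bit \<Rightarrow> 'v set)
    \<Rightarrow> (('m::finite, 'n::finite) gl \<Rightarrow> 'v \<Rightarrow> 'v) \<Rightarrow> bool" where
  "irreducible_module sc Vgr \<pi> \<longleftrightarrow> (UNIV :: 'v set) \<noteq> {0}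
     \<and> (\<forall>U. module.subspace sc U \<and> is_direct_sum UNIV (\<lambda>p. U \<inter> Vgr p) U
            \<and> (\<forall>X. \<pi> X ` U \<subseteq> U) \<longrightarrow> U = {0} \<or> U = UNIV)"

definition pos_def_hermitian ::
  "(complex \<Rightarrow> 'v::ab_group_add \<Rightarrow> 'v) \<Rightarrow> ('v \<Rightarrow> 'v \<Rightarrow> complex) \<Rightarrow> bool" where
  "pos_def_hermitian sc H \<longleftrightarrow>
     (\<forall>u v w. H (u + v) w = H u w + H v w)
     \<and> (\<forall>c v w. H (sc c v) w = c * H v w)
     \<and> (\<forall>v w. H w v = cnj (H v w))
     \<and> (\<forall>v. v \<noteq> 0 \<longrightarrow> H v v \<in> \<real> \<and> Re (H v v) > 0)"

definition unitary_module ::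
  "(complex \<Rightarrow> 'v::ab_group_add \<Rightarrow> 'v)
    \<Rightarrow> (('m::finite, 'n::finite) gl \<Rightarrow> 'v \<Rightarrow> 'v) \<Rightarrow> bool" where
  "unitary_module sc \<pi> \<longleftrightarrow> (\<exists>H. pos_def_hermitian sc H
     \<and> (\<forall>X v w. H (\<pi> X v) w = H v (\<pi> (omega X) w)))"


section \<open>Polynomials and the tensor product \<open>V \<otimes> \<complex>[x\<^sub>1,...,x\<^sub>m\<^sub>n]\<close>\<close>

type_synonym 'p monom = "'p \<Rightarrow>\<^sub>0 nat"
type_synonym 'p cpoly = "'p monom \<Rightarrow>\<^sub>0 complex"

text \<open>
  \<open>V \<otimes> \<complex>[x]\<close> is the space of polynomials with coefficients in \<open>V\<close>, the pure tensor
  \<open>v \<otimes> f\<close> being the polynomial with coefficients \<open>f\<^sub>\<mu> v\<close>. The lemma \<open>tensor_universal\<close> below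
  is the universal property.
\<close>

type_synonym ('p, 'v) vpoly = "'p monom \<Rightarrow>\<^sub>0 'v"

definition monomial :: "'p monom \<Rightarrow> 'p cpoly" where
  "monomial \<mu> = Poly_Mapping.single \<mu> 1"

definition var :: "'p \<Rightarrow> 'p cpoly" where
  "var p = monomial (Poly_Mapping.single p 1)"

definition pscale :: "complex \<Rightarrow> 'p cpoly \<Rightarrow> 'p cpoly" where
  "pscale c f = Poly_Mapping.map ((*) c) f"

text \<open>The subtraction of exponents truncates only where the coefficient vanishes.\<close>

definition pderiv :: "'p \<Rightarrow> 'p cpoly \<Rightarrow> 'p cpoly" where
  "pderiv p f = (\<Sum>\<mu>\<in>Poly_Mapping.keys f.
     Poly_Mapping.single (\<mu> - Poly_Mapping.single p 1)
       (of_nat (Poly_Mapping.lookup \<mu> p) * Poly_Mapping.lookup f \<mu>))"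

definition tscale ::
  "(complex \<Rightarrow> 'v::ab_group_add \<Rightarrow> 'v) \<Rightarrow> complex \<Rightarrow> ('p, 'v) vpoly \<Rightarrow> ('p, 'v) vpoly" where
  "tscale sc c t = Poly_Mapping.map (sc c) t"

definition tensor ::
  "(complex \<Rightarrow> 'v::ab_group_add \<Rightarrow> 'v) \<Rightarrow> 'v \<Rightarrow> 'p cpoly \<Rightarrow> ('p, 'v) vpoly" where
  "tensor sc v f =
     (\<Sum>\<mu>\<in>Poly_Mapping.keys f. Poly_Mapping.single \<mu> (sc (Poly_Mapping.lookup f \<mu>) v))"

definition op_tensor ::
  "(complex \<Rightarrow> 'v::ab_group_add \<Rightarrow> 'v) \<Rightarrow> ('v \<Rightarrow> 'v) \<Rightarrow> ('p cpoly \<Rightarrow> 'p cpoly)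
    \<Rightarrow> ('p, 'v) vpoly \<Rightarrow> ('p, 'v) vpoly" where
  "op_tensor sc a b t =
     (\<Sum>\<mu>\<in>Poly_Mapping.keys t. tensor sc (a (Poly_Mapping.lookup t \<mu>)) (b (monomial \<mu>)))"

definition vhom :: "nat \<Rightarrow> ('p::finite, 'v::zero) vpoly set" where
  "vhom i = {t. \<forall>\<mu>\<in>Poly_Mapping.keys t. (\<Sum>p\<in>UNIV. Poly_Mapping.lookup \<mu> p) = i}"


section \<open>The Dirac operator, cohomology and homology\<close>

text \<open>The generator \<open>x\<^sub>p\<close> of the Weyl algebra acts as multiplication by \<^term>\<open>var p\<close>,
  the generator \<open>\<partial>\<^sub>p\<close> as \<^term>\<open>pderiv p\<close>.\<close>

definition alpha ::
  "('m::finite, 'n::finite) gl \<Rightarrow> ('m \<times> 'n) cpoly \<Rightarrow> ('m \<times> 'n) cpoly" where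
  "alpha X f =
     - (\<Sum>i\<in>UNIV. \<Sum>j\<in>UNIV. pscale (2 * B X (sbracket (xx i) (dd j))) (var j * pderiv i f))
     - (\<Sum>i\<in>UNIV. pscale (B X (sbracket (dd i) (xx i))) f)"

definition lin_poly :: "('m::finite, 'n::finite) gl \<Rightarrow> ('m \<times> 'n) cpoly" where
  "lin_poly Y = (\<Sum>p\<in>UNIV. pscale (Y $ Inr (snd p) $ Inl (fst p)) (var p))"

text \<open>
  The adjoint action of \<open>\<gg>\<^sub>0\<close> on \<open>S(\<gg>\<^sub>-) = \<complex>[x]\<close> is the derivation extending
  \<open>x\<^sub>p \<mapsto> [X, x\<^sub>p]\<close>; here \<^term>\<open>lin_poly Y\<close> is \<open>Y \<in> \<gg>\<^sub>-\<close> as an element of \<open>S\<^sup>1(\<gg>\<^sub>-)\<close>.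
\<close>

definition ad_S ::
  "('m::finite, 'n::finite) gl \<Rightarrow> ('m \<times> 'n) cpoly \<Rightarrow> ('m \<times> 'n) cpoly" where
  "ad_S X f = (\<Sum>p\<in>UNIV. lin_poly (sbracket X (xx p)) * pderiv p f)"

definition act_M ::
  "(complex \<Rightarrow> 'v::ab_group_add \<Rightarrow> 'v) \<Rightarrow> (('m::finite, 'n::finite) gl \<Rightarrow> 'v \<Rightarrow> 'v)
    \<Rightarrow> ('m, 'n) gl \<Rightarrow> ('m \<times> 'n, 'v) vpoly \<Rightarrow> ('m \<times> 'n, 'v) vpoly" where
  "act_M sc \<pi> X t = op_tensor sc (\<pi> X) id t + op_tensor sc id (alpha X) t"

definition act_S ::
  "(complex \<Rightarrow> 'v::ab_group_add \<Rightarrow> 'v) \<Rightarrow> (('m::finite, 'n::finite) gl \<Rightarrow> 'v \<Rightarrow> 'v)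
    \<Rightarrow> ('m, 'n) gl \<Rightarrow> ('m \<times> 'n, 'v) vpoly \<Rightarrow> ('m \<times> 'n, 'v) vpoly" where
  "act_S sc \<pi> X t = op_tensor sc (\<pi> X) id t + op_tensor sc id (ad_S X) t"

definition d_op ::
  "(complex \<Rightarrow> 'v::ab_group_add \<Rightarrow> 'v) \<Rightarrow> (('m::finite, 'n::finite) gl \<Rightarrow> 'v \<Rightarrow> 'v)
    \<Rightarrow> ('m \<times> 'n, 'v) vpoly \<Rightarrow> ('m \<times> 'n, 'v) vpoly" where
  "d_op sc \<pi> t = (\<Sum>i\<in>UNIV. op_tensor sc (\<pi> (dd i)) ((*) (var i)) t)"

definition delta_op ::
  "(complex \<Rightarrow> 'v::ab_group_add \<Rightarrow> 'v) \<Rightarrow> (('m::finite, 'n::finite) gl \<Rightarrow> 'v \<Rightarrow> 'v)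
    \<Rightarrow> ('m \<times> 'n, 'v) vpoly \<Rightarrow> ('m \<times> 'n, 'v) vpoly" where
  "delta_op sc \<pi> t = (\<Sum>i\<in>UNIV. op_tensor sc (\<pi> (xx i)) (pderiv i) t)"

definition D_op ::
  "(complex \<Rightarrow> 'v::ab_group_add \<Rightarrow> 'v) \<Rightarrow> (('m::finite, 'n::finite) gl \<Rightarrow> 'v \<Rightarrow> 'v)
    \<Rightarrow> ('m \<times> 'n, 'v) vpoly \<Rightarrow> ('m \<times> 'n, 'v) vpoly" where
  "D_op sc \<pi> t = tscale sc 2 (\<Sum>i\<in>UNIV. op_tensor sc (\<pi> (dd i)) ((*) (var i)) t
                                - op_tensor sc (\<pi> (xx i)) (pderiv i) t)"

definition dirac_cohomology ::
  "(complex \<Rightarrow> 'v::ab_group_add \<Rightarrow> 'v) \<Rightarrow> (('m::finite, 'n::finite) gl \<Rightarrow> 'v \<Rightarrow> 'v)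
    \<Rightarrow> (('m, 'n) gl, ('m \<times> 'n, 'v) vpoly set) lmod" where
  "dirac_cohomology sc \<pi> = quotmod (tscale sc) (act_M sc \<pi>)
     (ker (D_op sc \<pi>)) (ker (D_op sc \<pi>) \<inter> range (D_op sc \<pi>))"

definition cohomology_plus ::
  "(complex \<Rightarrow> 'v::ab_group_add \<Rightarrow> 'v) \<Rightarrow> (('m::finite, 'n::finite) gl \<Rightarrow> 'v \<Rightarrow> 'v)
    \<Rightarrow> nat \<Rightarrow> (('m, 'n) gl, ('m \<times> 'n, 'v) vpoly set) lmod" where
  "cohomology_plus sc \<pi> i = quotmod (tscale sc) (act_S sc \<pi>)
     (ker (d_op sc \<pi>) \<inter> vhom i)
     (case i of 0 \<Rightarrow> {0} | Suc j \<Rightarrow> d_op sc \<pi> ` vhom j)"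

definition homology_minus ::
  "(complex \<Rightarrow> 'v::ab_group_add \<Rightarrow> 'v) \<Rightarrow> (('m::finite, 'n::finite) gl \<Rightarrow> 'v \<Rightarrow> 'v)
    \<Rightarrow> nat \<Rightarrow> (('m, 'n) gl, ('m \<times> 'n, 'v) vpoly set) lmod" where
  "homology_minus sc \<pi> i = quotmod (tscale sc) (act_S sc \<pi>)
     (ker (delta_op sc \<pi>) \<inter> vhom i) (delta_op sc \<pi> ` vhom (Suc i))"


subsection \<open>Universal property of the tensor product\<close>

lemma lookup_tscale:
  assumes "vector_space sc"
  shows "Poly_Mapping.lookup (tscale sc c t) \<mu> = sc c (Poly_Mapping.lookup t \<mu>)"
proof -
  interpret vector_space sc by fact
  show ?thesis unfolding tscale_def
    by (simp add: Poly_Mapping.map.rep_eq when_def)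
qed

lemma lookup_pscale: "Poly_Mapping.lookup (pscale c f) \<mu> = c * Poly_Mapping.lookup f \<mu>"
  unfolding pscale_def by (simp add: Poly_Mapping.map.rep_eq when_def)

lemma lookup_tensor:
  assumes "vector_space sc"
  shows "Poly_Mapping.lookup (tensor sc v f) \<mu> = sc (Poly_Mapping.lookup f \<mu>) v"
proof -
  interpret vector_space sc by fact
  show ?thesis
    unfolding tensor_def
    by (auto simp: lookup_sum lookup_single when_def in_keys_iff sum.delta)
qed

lemma vector_space_tscale:
  assumes "vector_space sc"
  shows "vector_space (tscale sc)"
proof -
  interpret vector_space sc by fact
  show ?thesis
    by unfold_locales
      (auto intro!: poly_mapping_eqI
        simp: lookup_tscale[OF assms] lookup_add scale_right_distrib scale_left_distrib)
qed

lemma vector_space_pscale: "vector_space pscale"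
  by unfold_locales (auto intro!: poly_mapping_eqI simp: lookup_pscale lookup_add algebra_simps)

lemma tensor_bilinear:
  assumes "vector_space sc"
  shows "Vector_Spaces.linear sc (tscale sc) (\<lambda>v. tensor sc v f)"
    and "Vector_Spaces.linear pscale (tscale sc) (\<lambda>f. tensor sc v f)"
proof -
  interpret vector_space sc by fact
  note vs = assms vector_space_tscale[OF assms] vector_space_pscale
  show "Vector_Spaces.linear sc (tscale sc) (\<lambda>v. tensor sc v f)"
    unfolding Vector_Spaces.linear_iff using vs
    by (auto intro!: poly_mapping_eqI
        simp: lookup_tscale lookup_tensor lookup_add scale_right_distrib scale_left_commute)
  show "Vector_Spaces.linear pscale (tscale sc) (\<lambda>f. tensor sc v f)"
    unfolding Vector_Spaces.linear_iff using vs
    by (auto intro!: poly_mapping_eqI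
        simp: lookup_tscale lookup_tensor lookup_pscale lookup_add scale_left_distrib)
qed

lemma single_sum_keys: "t = (\<Sum>\<mu>\<in>Poly_Mapping.keys t. Poly_Mapping.single \<mu> (Poly_Mapping.lookup t \<mu>))"
  by (rule poly_mapping_eqI) (auto simp: lookup_sum lookup_single when_def in_keys_iff sum.delta)

lemma tensor_monomial:
  assumes "vector_space sc"
  shows "tensor sc v (monomial \<mu>) = Poly_Mapping.single \<mu> v"
proof -
  interpret vector_space sc by fact
  show ?thesis
    by (rule poly_mapping_eqI)
      (auto simp: lookup_tensor[OF assms] monomial_def lookup_single when_def)
qed

lemma tensor_universal:
  fixes sc :: "complex \<Rightarrow> 'v::ab_group_add \<Rightarrow> 'v" and sc' :: "complex \<Rightarrow> 'w::ab_group_add \<Rightarrow> 'w"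
    and h :: "'v \<Rightarrow> 'p cpoly \<Rightarrow> 'w"
  assumes V: "vector_space sc"
    and h1: "\<And>f. Vector_Spaces.linear sc sc' (\<lambda>v. h v f)"
    and h2: "\<And>v. Vector_Spaces.linear pscale sc' (h v)"
  shows "\<exists>!g. Vector_Spaces.linear (tscale sc) sc' g \<and> (\<forall>v f. g (tensor sc v f) = h v f)"
proof -
  interpret V: vector_space sc by fact
  interpret T: vector_space "tscale sc :: complex \<Rightarrow> ('p, 'v) vpoly \<Rightarrow> _"
    by (rule vector_space_tscale[OF V])
  interpret h1: Vector_Spaces.linear sc sc' "\<lambda>v. h v f" for f by (rule h1)
  interpret h2: Vector_Spaces.linear pscale sc' "h v" for v by (rule h2)
  have vs': "vector_space sc'" by unfold_locales
  define g where "g = (\<lambda>t. \<Sum>\<mu>\<in>Poly_Mapping.keys t. h (Poly_Mapping.lookup t \<mu>) (monomial \<mu>))"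
  have g_sup: "g t = (\<Sum>\<mu>\<in>S. h (Poly_Mapping.lookup t \<mu>) (monomial \<mu>))"
    if "finite S" "Poly_Mapping.keys t \<subseteq> S" for t S
    unfolding g_def using that
    by (intro sum.mono_neutral_left) (auto simp: in_keys_iff h1.zero)
  have g_add: "g (s + t) = g s + g t" for s t
  proof -
    let ?S = "Poly_Mapping.keys s \<union> Poly_Mapping.keys t"
    have "Poly_Mapping.keys (s + t) \<subseteq> ?S" by (rule keys_add)
    then show ?thesis
      by (simp add: g_sup[of ?S] lookup_add h1.add sum.distrib)
  qed
  have g_scale: "g (tscale sc c t) = sc' c (g t)" for c t
  proof -
    have "Poly_Mapping.keys (tscale sc c t) \<subseteq> Poly_Mapping.keys t"
      by (auto simp: in_keys_iff lookup_tscale[OF V])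
    then show ?thesis
      by (simp add: g_sup[of "Poly_Mapping.keys t"] lookup_tscale[OF V] h1.scale
          h1.vs2.scale_sum_right)
  qed
  have lin: "Vector_Spaces.linear (tscale sc) sc' g"
    unfolding Vector_Spaces.linear_iff
    using g_add g_scale vs' T.vector_space_axioms by auto
  have single_eq: "Poly_Mapping.single \<mu> c = pscale c (monomial \<mu>)" for \<mu> :: "'p monom" and c
    by (rule poly_mapping_eqI) (auto simp: lookup_pscale monomial_def lookup_single when_def)
  have g_tensor: "g (tensor sc v f) = h v f" for v f
  proof -
    have "Poly_Mapping.keys (tensor sc v f) \<subseteq> Poly_Mapping.keys f"
      by (auto simp: in_keys_iff lookup_tensor[OF V])
    then have "g (tensor sc v f)
        = (\<Sum>\<mu>\<in>Poly_Mapping.keys f. sc' (Poly_Mapping.lookup f \<mu>) (h v (monomial \<mu>)))"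
      by (simp add: g_sup[of "Poly_Mapping.keys f"] lookup_tensor[OF V] h1.scale)
    also have "\<dots> = h v (\<Sum>\<mu>\<in>Poly_Mapping.keys f. Poly_Mapping.single \<mu> (Poly_Mapping.lookup f \<mu>))"
      by (simp add: h2.sum h2.scale single_eq)
    also have "\<dots> = h v f"
      by (simp flip: single_sum_keys)
    finally show ?thesis .
  qed
  have uniq: "g' = g"
    if g': "Vector_Spaces.linear (tscale sc) sc' g'" "\<forall>v f. g' (tensor sc v f) = h v f" for g'
  proof
    fix t
    interpret g': Vector_Spaces.linear "tscale sc" sc' g' by (rule g')
    have "g' t = g' (\<Sum>\<mu>\<in>Poly_Mapping.keys t. tensor sc (Poly_Mapping.lookup t \<mu>) (monomial \<mu>))"
      by (simp add: tensor_monomial[OF V] flip: single_sum_keys)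
    also have "\<dots> = g t"
      by (simp add: g'.sum g'(2) g_def)
    finally show "g' t = g t" .
  qed
  show ?thesis
    using lin g_tensor uniq by blast
qed

lemma op_tensor_tensor:
  fixes sc :: "complex \<Rightarrow> 'v::ab_group_add \<Rightarrow> 'v" and b :: "'p cpoly \<Rightarrow> 'p cpoly"
    and f :: "'p cpoly"
  assumes a: "Vector_Spaces.linear sc sc a" and b: "Vector_Spaces.linear pscale pscale b"
  shows "op_tensor sc a b (tensor sc v f) = tensor sc (a v) (b f)"
proof -
  interpret a: Vector_Spaces.linear sc sc a by (rule a)
  interpret b: Vector_Spaces.linear pscale pscale b by (rule b)
  have V: "vector_space sc" by unfold_locales
  note t1 = tensor_bilinear(1)[OF V] and t2 = tensor_bilinear(2)[OF V]
  interpret t1: Vector_Spaces.linear sc "tscale sc" "\<lambda>v. tensor sc v f" for f :: "'p cpoly"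
    by (rule t1)
  interpret t2: Vector_Spaces.linear pscale "tscale sc" "\<lambda>f :: 'p cpoly. tensor sc v f" for v by (rule t2)
  have single_eq: "Poly_Mapping.single \<mu> c = pscale c (monomial \<mu>)" for \<mu> :: "'p monom" and c
    by (rule poly_mapping_eqI) (auto simp: lookup_pscale monomial_def lookup_single when_def)
  have "op_tensor sc a b (tensor sc v f)
      = (\<Sum>\<mu>\<in>Poly_Mapping.keys f.
          tensor sc (a (Poly_Mapping.lookup (tensor sc v f) \<mu>)) (b (monomial \<mu>)))"
    unfolding op_tensor_def
    by (intro sum.mono_neutral_left)
      (auto simp: in_keys_iff lookup_tensor[OF V] t1.zero a.zero)
  also have "\<dots> = tensor sc (a v)
      (b (\<Sum>\<mu>\<in>Poly_Mapping.keys f. Poly_Mapping.single \<mu> (Poly_Mapping.lookup f \<mu>)))"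
    by (simp add: lookup_tensor[OF V] a.scale t1.scale t2.sum t2.scale b.sum b.scale single_eq)
  also have "\<dots> = tensor sc (a v) (b f)"
    by (simp flip: single_sum_keys)
  finally show "op_tensor sc a b (tensor sc v f) = tensor sc (a v) (b f)" .
qed

end

theory Submission
  imports Defs
begin

text \<open>
  This is Hodge theory for the differentials \<open>d\<close> and \<open>\<delta>\<close>. Unitarity provides a positive definite
  form on \<open>V\<close> for which \<open>\<omega>\<close> gives the adjoint, and \<open>\<omega>\<close> exchanges the root vectors \<open>\<partial>\<^sub>p = E\<^sub>i\<^sub>k\<close>
  and \<open>x\<^sub>p = E\<^sub>k\<^sub>i\<close>. On \<open>\<complex>[x]\<close> the Fischer form, \<open>\<langle>x\<^sup>\<mu>, x\<^sup>\<nu>\<rangle> = \<mu>!\<close> if \<open>\<mu> = \<nu>\<close> and \<open>0\<close> otherwise, makes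
  multiplication by \<open>x\<^sub>p\<close> adjoint to \<open>\<partial>/\<partial>x\<^sub>p\<close>. For the product form on \<open>V \<otimes> \<complex>[x]\<close> the operators
  \<open>d = \<Sum> \<partial>\<^sub>p \<otimes> x\<^sub>p\<close> and \<open>\<delta> = \<Sum> x\<^sub>p \<otimes> \<partial>\<^sub>p\<close> are therefore adjoint (\<open>d_adjoint\<close>). Both have square zero,
  since the elements of \<open>\<gg>\<^sub>+\<close> anticommute on \<open>V\<close>, as do those of \<open>\<gg>\<^sub>-\<close>.

  Consequently \<open>Im d\<close> and \<open>Im \<delta>\<close> are orthogonal, and \<open>Ker D = Ker d \<inter> Ker \<delta>\<close>, the space of harmonic
  elements, is orthogonal to both. What remains is that the three spaces together are everything.
  This follows once the selfadjoint Laplacian \<open>d\<delta> + \<delta>d\<close> is known to split the space into its kernel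
  and its image, and for that it suffices that each element lies in a finite-dimensional subspace
  stable under the Laplacian (\<open>hodge_decomposition\<close>). Such subspaces exist because the Laplacian
  preserves the degree of polynomials and because every vector of \<open>V\<close> lies in a finite-dimensional
  \<open>\<gg>\<close>-submodule: it lies in a finite-dimensional \<open>\<gg>\<^sub>0\<close>-submodule, and closing that one under
  \<open>\<gg>\<^sub>+\<close> and then under \<open>\<gg>\<^sub>-\<close> keeps it finite-dimensional, both being spanned by finitely many
  anticommuting operators (\<open>g0_invariant_locally_finite\<close>).

  For the isomorphisms, \<open>Ker D \<inter> Im D = 0\<close> shows that \<open>H\<^sub>D(V)\<close> is \<open>Ker D\<close> itself, and the decompositions
  of \<open>Ker d\<close> and \<open>Ker \<delta>\<close> show that the homogeneous components of harmonic elements represent the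
  classes of \<open>H\<^sup>*\<close> and of \<open>H\<^sub>*\<close> uniquely (\<open>harmonic_representatives\<close>). These maps respect \<open>\<gg>\<^sub>0\<close>
  because \<open>d\<close> and \<open>\<delta>\<close> are built from dual bases and hence \<open>\<gg>\<^sub>0\<close>-invariant, and the twist by
  \<open>\<complex>\<^bsub>-\<rho>\<^sub>1\<^esub>\<close> is the difference between the Weil representation \<open>\<alpha>\<close> and the adjoint action on
  \<open>S(\<gg>\<^sub>-)\<close> (\<open>alpha_eq_ad_S\<close>).
\<close>

section \<open>Endomorphisms of finite-dimensional subspaces\<close>

context vector_space
begin

text \<open>A basis of \<open>U\<close> is mapped to an independent set of the same size, which no vector of \<open>U\<close> can
  enlarge.\<close>

lemma inj_endo_surj:
  assumes lin: "Vector_Spaces.linear scale scale f"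
    and U: "subspace U" "finite S" "U \<subseteq> span S" and inv: "f ` U \<subseteq> U"
    and inj: "\<And>x. x \<in> U \<Longrightarrow> f x = 0 \<Longrightarrow> x = 0"
  shows "f ` U = U"
proof -
  interpret f: Vector_Spaces.linear scale scale f by fact
  obtain C where C: "C \<subseteq> U" "independent C" "U \<subseteq> span C"
    by (rule maximal_independent_subset)
  have spC: "span C = U"
    using C U(1) by (simp add: span_minimal subset_antisym)
  have finC: "finite C"
    using independent_span_bound[OF U(2) C(2)] C(1) U(3) by blast
  have injC: "inj_on f (span C)"
    unfolding spC f.inj_on_iff_eq_0[OF U(1)] using inj by blast
  have ind: "independent (f ` C)"
    by (rule f.independent_injective_image[OF C(2) injC])
  have card: "card (f ` C) = card C"
    using injC span_superset by (intro card_image) (blast intro: inj_on_subset)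
  have "U \<subseteq> span (f ` C)"
  proof (rule ccontr)
    assume "\<not> U \<subseteq> span (f ` C)"
    then obtain a where a: "a \<in> U" "a \<notin> span (f ` C)" by blast
    then have "independent (insert a (f ` C))"
      using ind by (rule_tac independent_insertI)
    moreover have "insert a (f ` C) \<subseteq> span C"
      using a C inv spC by blast
    ultimately have "card (insert a (f ` C)) \<le> card C"
      using independent_span_bound[OF finC] by blast
    moreover have "a \<notin> f ` C" using a(2) span_base by blast
    ultimately show False using card finC by simp
  qed
  then have "U \<subseteq> f ` U" by (simp add: f.span_image spC)
  with inv show ?thesis by blast
qed

end

section \<open>Differentials with an adjoint\<close>

text \<open>The condition \<open>loc_fin\<close> stands in for finite dimension or completeness of the space: it is what
  makes the image of the Laplacian a complement of its kernel.\<close>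

locale adjoint_differentials = vector_space scale
  for scale :: "complex \<Rightarrow> 'a::ab_group_add \<Rightarrow> 'a" +
  fixes ip :: "'a \<Rightarrow> 'a \<Rightarrow> complex" and d \<delta> :: "'a \<Rightarrow> 'a"
  assumes herm: "pos_def_hermitian scale ip"
    and lin_d: "Vector_Spaces.linear scale scale d"
    and lin_\<delta>: "Vector_Spaces.linear scale scale \<delta>"
    and adj: "ip (d s) t = ip s (\<delta> t)"
    and dd0: "d (d t) = 0"
    and \<delta>\<delta>0: "\<delta> (\<delta> t) = 0"
    and loc_fin: "\<exists>F S. subspace F \<and> finite S \<and> F \<subseteq> span S \<and> t \<in> F
        \<and> (\<lambda>s. d (\<delta> s) + \<delta> (d s)) ` F \<subseteq> F"
begin

sublocale d: Vector_Spaces.linear scale scale d by (rule lin_d)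
sublocale \<delta>: Vector_Spaces.linear scale scale \<delta> by (rule lin_\<delta>)

lemma ip_add: "ip (u + v) w = ip u w + ip v w"
  and ip_cnj: "ip w v = cnj (ip v w)"
  using herm unfolding pos_def_hermitian_def by blast+

lemma ip_zero_left [simp]: "ip 0 w = 0"
  using ip_add[of 0 0 w] by simp

lemma ip_zero_right [simp]: "ip w 0 = 0"
  using ip_cnj[of w 0] by simp

lemma ip_add_right: "ip w (u + v) = ip w u + ip w v"
  using ip_cnj[of w "u + v"] ip_cnj[of w u] ip_cnj[of w v] by (simp add: ip_add)

lemma ip_sum_right: "ip w (sum f A) = (\<Sum>i\<in>A. ip w (f i))"
  by (induction A rule: infinite_finite_induct) (simp_all add: ip_add_right)

lemma ip_pos: "v \<noteq> 0 \<Longrightarrow> Re (ip v v) > 0"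
  using herm unfolding pos_def_hermitian_def by blast

lemma ip_definite: "ip v v = 0 \<Longrightarrow> v = 0"
  using ip_pos[of v] by fastforce

lemma ip_nonneg: "0 \<le> Re (ip v v)"
  using ip_pos[of v] by (cases "v = 0") simp_all

lemma adj': "ip (\<delta> s) t = ip s (d t)"
  using ip_cnj[of "\<delta> s" t] ip_cnj[of s "d t"] by (simp add: adj)

definition harmonic :: "'a set" where
  "harmonic = ker d \<inter> ker \<delta>"

abbreviation laplacian :: "'a \<Rightarrow> 'a" where
  "laplacian t \<equiv> d (\<delta> t) + \<delta> (d t)"

lemma linear_laplacian: "Vector_Spaces.linear scale scale laplacian"
  unfolding Vector_Spaces.linear_iff using vector_space_axioms
  by (simp add: d.add \<delta>.add d.scale \<delta>.scale scale_right_distrib)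

lemma laplacian_selfadjoint: "ip (laplacian s) t = ip s (laplacian t)"
  by (simp add: ip_add ip_add_right adj adj' add.commute)

text \<open>\<open>\<langle>(d\<delta> + \<delta>d) t, t\<rangle> = \<langle>\<delta> t, \<delta> t\<rangle> + \<langle>d t, d t\<rangle>\<close>, and both summands are nonnegative.\<close>

lemma laplacian_eq_0: assumes "laplacian t = 0" shows "t \<in> harmonic"
proof -
  have "ip (\<delta> t) (\<delta> t) + ip (d t) (d t) = ip (laplacian t) t"
    using adj[of "\<delta> t" t] adj'[of "d t" t] by (simp add: ip_add)
  then have *: "Re (ip (\<delta> t) (\<delta> t)) + Re (ip (d t) (d t)) = 0"
    using assms by (metis ip_zero_left plus_complex.sel(1) zero_complex.sel(1))
  have real: "ip v v = 0" if "Re (ip v v) = 0" for v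
    using ip_cnj[of v v] that by (simp add: complex_eq_iff)
  show ?thesis
    using * ip_nonneg[of "\<delta> t"] ip_nonneg[of "d t"] real ip_definite
    unfolding harmonic_def ker_def by (simp add: add_nonneg_eq_0_iff)
qed

text \<open>A selfadjoint operator has no nilpotent part: it is injective on its own image, hence
  bijective there as soon as it acts on a finite-dimensional space.\<close>

lemma hodge_decomposition:
  obtains a u w where "t = a + d u + \<delta> w" "a \<in> harmonic"
proof -
  interpret L: Vector_Spaces.linear scale scale laplacian by (rule linear_laplacian)
  obtain F S where F: "subspace F" "finite S" "F \<subseteq> span S" "t \<in> F" "laplacian ` F \<subseteq> F"
    using loc_fin[of t] by blast
  let ?G = "laplacian ` F"
  have "laplacian ` ?G = ?G"
  proof (rule inj_endo_surj[OF linear_laplacian _ F(2)])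
    show "subspace ?G" using F(1) by (rule L.subspace_image)
    show "?G \<subseteq> span S" using F by blast
    show "laplacian ` ?G \<subseteq> ?G" using F by blast
    fix x assume "x \<in> ?G" and 0: "laplacian x = 0"
    then obtain y where "x = laplacian y" by blast
    then have "ip x x = ip y (laplacian x)" using laplacian_selfadjoint[of y x] by simp
    then show "x = 0" unfolding 0 using ip_definite by simp
  qed
  moreover have "laplacian t \<in> ?G" using F by blast
  ultimately obtain b where b: "laplacian t = laplacian (laplacian b)" by blast
  show thesis
  proof (rule that)
    show "t = (t - laplacian b) + d (\<delta> b) + \<delta> (d b)" by simp
    have "laplacian (t - laplacian b) = 0" unfolding L.diff using b by simp
    then show "t - laplacian b \<in> harmonic" by (rule laplacian_eq_0)
  qed
qed

lemma orthogonal: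
  shows "a \<in> harmonic \<Longrightarrow> ip a (d u) = 0"
    and "a \<in> harmonic \<Longrightarrow> ip a (\<delta> u) = 0"
    and "ip (d u) (\<delta> w) = 0"
  using adj'[of a u] adj[of a u] adj[of u "\<delta> w"] by (simp_all add: harmonic_def ker_def \<delta>\<delta>0)

text \<open>\<open>d t\<close> is orthogonal to \<open>\<delta> t\<close>, so that they can only be equal if both vanish.\<close>

lemma ker_dirac: "ker (\<lambda>t. d t - \<delta> t) = harmonic"
proof (intro equalityI subsetI)
  fix t assume "t \<in> ker (\<lambda>t. d t - \<delta> t)"
  then have eq: "d t = \<delta> t" by (simp add: ker_def)
  have "ip (d t) (d t) = 0" using orthogonal(3)[of t t] eq by simp
  then show "t \<in> harmonic" using ip_definite eq by (auto simp: harmonic_def ker_def)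
qed (simp add: harmonic_def ker_def)

lemma range_dirac_harmonic: "harmonic \<inter> range (\<lambda>t. d t - \<delta> t) = {0}"
proof -
  have "x = 0" if "x \<in> harmonic" "x = d t - \<delta> t" for x t
  proof -
    have "x = d t + \<delta> (- t)" using that(2) by (simp add: \<delta>.neg)
    then have "ip x x = ip x (d t) + ip x (\<delta> (- t))" by (metis ip_add_right)
    then show ?thesis using orthogonal that(1) ip_definite by simp
  qed
  moreover have "0 \<in> harmonic" by (simp add: harmonic_def ker_def)
  moreover have "0 = d 0 - \<delta> 0" by simp
  ultimately show ?thesis by blast
qed

text \<open>If \<open>d\<close> kills \<open>t\<close>, it also kills the summand \<open>\<delta> w\<close> of its decomposition; then \<open>\<delta> w\<close> is orthogonal
  to itself and drops out. The same happens with \<open>d\<close> and \<open>\<delta>\<close> exchanged.\<close>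

lemma ker_d_decomposition:
  assumes "t \<in> ker d" obtains a u where "t = a + d u" "a \<in> harmonic"
proof -
  obtain a u w where *: "t = a + d u + \<delta> w" "a \<in> harmonic" by (rule hodge_decomposition)
  have "d (\<delta> w) = 0"
    using assms * by (auto simp: ker_def harmonic_def d.add dd0)
  then have "ip (\<delta> w) (\<delta> w) = 0" by (simp add: adj')
  then have "\<delta> w = 0" by (rule ip_definite)
  with * that show thesis by simp
qed

lemma ker_\<delta>_decomposition:
  assumes "t \<in> ker \<delta>" obtains a w where "t = a + \<delta> w" "a \<in> harmonic"
proof -
  obtain a u w where *: "t = a + d u + \<delta> w" "a \<in> harmonic" by (rule hodge_decomposition)
  have "\<delta> (d u) = 0"
    using assms * by (auto simp: ker_def harmonic_def \<delta>.add \<delta>\<delta>0)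
  then have "ip (d u) (d u) = 0" by (simp add: adj)
  then have "d u = 0" by (rule ip_definite)
  with * that show thesis by simp
qed

lemma harmonic_exact: "a \<in> harmonic \<Longrightarrow> a \<in> range d \<Longrightarrow> a = 0"
  "a \<in> harmonic \<Longrightarrow> a \<in> range \<delta> \<Longrightarrow> a = 0"
  using orthogonal(1,2)[of a] ip_definite[of a] by auto

text \<open>Pairing a vanishing sum with one of its terms leaves the norm of that term, so that a
  representation as a sum is unique.\<close>

lemma orthogonal_direct_sum:
  assumes sub: "\<And>A. A \<in> set As \<Longrightarrow> subspace A"
    and orth: "\<And>i j a b. i < length As \<Longrightarrow> j < length As \<Longrightarrow> i \<noteq> j \<Longrightarrow> a \<in> As ! i \<Longrightarrow> b \<in> As ! j
        \<Longrightarrow> ip a b = 0"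
    and U: "\<And>u. u \<in> U \<longleftrightarrow> (\<exists>f. (\<forall>i<length As. f i \<in> As ! i) \<and> u = (\<Sum>i<length As. f i))"
  shows "is_direct_sum_list As U"
proof -
  let ?n = "length As"
  let ?F = "{f. finite {i. f i \<noteq> 0} \<and> (\<forall>i\<in>{..<?n}. f i \<in> As ! i) \<and> (\<forall>i. i \<notin> {..<?n} \<longrightarrow> f i = 0)}"
  let ?s = "\<lambda>f :: nat \<Rightarrow> 'a. \<Sum>i | f i \<noteq> 0. f i"
  have s: "?s f = (\<Sum>i<?n. f i)" if "f \<in> ?F" for f
    using that by (intro sum.mono_neutral_left) auto
  have "inj_on ?s ?F"
  proof (rule inj_onI)
    fix f g assume f: "f \<in> ?F" and g: "g \<in> ?F" and "?s f = ?s g"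
    then have sum0: "(\<Sum>j<?n. f j - g j) = 0" by (simp only: s sum_subtractf) simp
    have "f i = g i" if i: "i < ?n" for i
    proof -
      have diff: "f j - g j \<in> As ! j" if "j < ?n" for j
        using f g that sub[of "As ! j"] by (auto intro!: subspace_diff)
      have "0 = ip (f i - g i) (\<Sum>j<?n. f j - g j)" by (simp add: sum0)
      also have "\<dots> = (\<Sum>j<?n. ip (f i - g i) (f j - g j))" by (rule ip_sum_right)
      also have "\<dots> = (\<Sum>j\<in>{i}. ip (f i - g i) (f j - g j))"
      proof (rule sum.mono_neutral_right)
        show "\<forall>j\<in>{..<?n} - {i}. ip (f i - g i) (f j - g j) = 0"
          using orth[OF i _ _ diff[OF i] diff] by simp
      qed (use i in auto)
      finally show ?thesis using ip_definite[of "f i - g i"] by simp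
    qed
    moreover have "f i = g i" if "\<not> i < ?n" for i using f g that by simp
    ultimately show "f = g" by (meson ext)
  qed
  moreover have "?s ` ?F = U"
  proof (intro equalityI subsetI)
    fix u assume "u \<in> ?s ` ?F"
    then obtain f where f: "f \<in> ?F" "u = ?s f" by blast
    have "\<forall>i<?n. f i \<in> As ! i" using f(1) by simp
    with f s show "u \<in> U" unfolding U by (metis (no_types, lifting))
  next
    fix u assume "u \<in> U"
    then obtain f where f: "\<forall>i<?n. f i \<in> As ! i" "u = (\<Sum>i<?n. f i)" unfolding U by blast
    let ?f = "\<lambda>i. if i < ?n then f i else 0"
    have "finite {i. ?f i \<noteq> 0}" by (rule finite_subset[of _ "{..<?n}"]) auto
    with f have "?f \<in> ?F" by simp
    moreover have "u = ?s ?f" unfolding s[OF \<open>?f \<in> ?F\<close>] f(2) by simp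
    ultimately show "u \<in> ?s ` ?F" by blast
  qed
  ultimately show ?thesis
    unfolding is_direct_sum_list_def is_direct_sum_def by (simp add: bij_betw_def)
qed

lemma subspaces: "subspace harmonic" "subspace (range d)" "subspace (range \<delta>)"
  by (simp_all add: harmonic_def ker_def subspace_inter d.subspace_kernel \<delta>.subspace_kernel
      d.subspace_image \<delta>.subspace_image)

lemma orthogonal':
  shows "a \<in> harmonic \<Longrightarrow> ip (d u) a = 0"
    and "a \<in> harmonic \<Longrightarrow> ip (\<delta> u) a = 0"
    and "ip (\<delta> w) (d u) = 0"
  using ip_cnj[of "d u" a] ip_cnj[of "\<delta> u" a] ip_cnj[of "\<delta> w" "d u"]
  by (simp_all add: orthogonal)

lemma direct_sum_harmonic:
  assumes C: "C = range d \<or> C = range \<delta>"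
    and U: "U = {a + c |a c. a \<in> harmonic \<and> c \<in> C}"
  shows "is_direct_sum_list [harmonic, C] U"
proof (rule orthogonal_direct_sum)
  show "subspace X" if "X \<in> set [harmonic, C]" for X using that C subspaces by auto
  show "ip a b = 0" if "i < length [harmonic, C]" "j < length [harmonic, C]" "i \<noteq> j" "a \<in> [harmonic, C] ! i" "b \<in> [harmonic, C] ! j"
    for i j a b
    using that C by (auto simp: less_Suc_eq orthogonal orthogonal')
  fix u
  have *: "(\<Sum>i<length [harmonic, C]. f i) = f 0 + f 1" for f :: "nat \<Rightarrow> 'a" by (simp add: numeral_2_eq_2)
  have **: "(\<forall>i<length [harmonic, C]. f i \<in> [harmonic, C] ! i) \<longleftrightarrow> f 0 \<in> harmonic \<and> f 1 \<in> C" for f :: "nat \<Rightarrow> 'a"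
    by (auto simp: less_Suc_eq)
  show "u \<in> U \<longleftrightarrow> (\<exists>f. (\<forall>i<length [harmonic, C]. f i \<in> [harmonic, C] ! i) \<and> u = (\<Sum>i<length [harmonic, C]. f i))"
    unfolding * ** U
  proof
    assume "u \<in> {a + c |a c. a \<in> harmonic \<and> c \<in> C}"
    then obtain a c where "a \<in> harmonic" "c \<in> C" "u = a + c" by blast
    then show "\<exists>f :: nat \<Rightarrow> 'a. (f 0 \<in> harmonic \<and> f 1 \<in> C) \<and> u = f 0 + f 1"
      by (intro exI[of _ "\<lambda>i. if i = 0 then a else c"]) simp
  qed blast
qed

theorem direct_sums:
  shows "is_direct_sum_list [harmonic, range d, range \<delta>] UNIV"
    and "is_direct_sum_list [harmonic, range d] (ker d)"
    and "is_direct_sum_list [harmonic, range \<delta>] (ker \<delta>)"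
proof -
  let ?As = "[harmonic, range d, range \<delta>]"
  show "is_direct_sum_list ?As UNIV"
  proof (rule orthogonal_direct_sum)
    show "subspace X" if "X \<in> set ?As" for X using that subspaces by auto
    show "ip a b = 0" if "i < length ?As" "j < length ?As" "i \<noteq> j" "a \<in> ?As ! i" "b \<in> ?As ! j"
      for i j a b
      using that by (auto simp: less_Suc_eq orthogonal orthogonal')
    fix u
    obtain a v w where *: "u = a + d v + \<delta> w" "a \<in> harmonic" by (rule hodge_decomposition)
    have "\<forall>i<length ?As. [a, d v, \<delta> w] ! i \<in> ?As ! i"
      using *(2) by (auto simp: less_Suc_eq)
    moreover have "u = (\<Sum>i<length ?As. [a, d v, \<delta> w] ! i)"
      using *(1) by (simp add: numeral_2_eq_2)
    ultimately show "u \<in> UNIV \<longleftrightarrow> (\<exists>f. (\<forall>i<length ?As. f i \<in> ?As ! i) \<and> u = (\<Sum>i<length ?As. f i))"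
      by blast
  qed
  show "is_direct_sum_list [harmonic, range d] (ker d)"
  proof (rule direct_sum_harmonic)
    show "ker d = {a + c |a c. a \<in> harmonic \<and> c \<in> range d}"
    proof (intro equalityI subsetI)
      fix t assume "t \<in> ker d"
      then obtain a u where "t = a + d u" "a \<in> harmonic" by (rule ker_d_decomposition)
      then show "t \<in> {a + c |a c. a \<in> harmonic \<and> c \<in> range d}" by blast
    qed (auto simp: ker_def harmonic_def d.add dd0)
  qed simp_all
  show "is_direct_sum_list [harmonic, range \<delta>] (ker \<delta>)"
  proof (rule direct_sum_harmonic)
    show "ker \<delta> = {a + c |a c. a \<in> harmonic \<and> c \<in> range \<delta>}"
    proof (intro equalityI subsetI)
      fix t assume "t \<in> ker \<delta>"
      then obtain a u where "t = a + \<delta> u" "a \<in> harmonic" by (rule ker_\<delta>_decomposition)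
      then show "t \<in> {a + c |a c. a \<in> harmonic \<and> c \<in> range \<delta>}" by blast
    qed (auto simp: ker_def harmonic_def \<delta>.add \<delta>\<delta>0)
  qed simp_all
qed

end

section \<open>Operators on \<open>V \<otimes> \<complex>[x]\<close>\<close>

abbreviation plinear :: "('p cpoly \<Rightarrow> 'p cpoly) \<Rightarrow> bool" where
  "plinear \<equiv> Vector_Spaces.linear pscale pscale"

lemma plinearI:
  assumes "\<And>f g. b (f + g) = b f + b g" "\<And>c f. b (pscale c f) = pscale c (b f)"
  shows "plinear b"
  unfolding Vector_Spaces.linear_iff using assms vector_space_pscale by auto

lemma plinear_add: "plinear b \<Longrightarrow> b (f + g) = b f + b g"
  and plinear_scale: "plinear b \<Longrightarrow> b (pscale c f) = pscale c (b f)"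
  by (auto simp: Vector_Spaces.linear_iff)

lemma pscale_simps:
  "pscale c (f + g) = pscale c f + pscale c g" "pscale (c + c') f = pscale c f + pscale c' f"
  "pscale c (pscale c' f) = pscale (c * c') f" "pscale c 0 = 0" "pscale 0 f = 0" "pscale 1 f = f"
  by (auto intro!: poly_mapping_eqI simp: lookup_pscale lookup_add algebra_simps)

lemma pscale_sum: "pscale c (\<Sum>i\<in>I. f i) = (\<Sum>i\<in>I. pscale c (f i))"
  by (auto intro!: poly_mapping_eqI simp: lookup_pscale lookup_sum sum_distrib_left)

lemma pscale_eq_times: "pscale c f = Poly_Mapping.single 0 c * f"
  unfolding pscale_def by (rule mult_map_scale_conv_mult)

lemma times_pscale: "f * pscale c g = pscale c (f * g)"
  by (simp add: pscale_eq_times ac_simps)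

lemma plinear_times: "plinear ((*) f)"
  by (rule plinearI) (simp_all add: distrib_left times_pscale)

lemma plinear_id: "plinear id"
  by (rule plinearI) simp_all

lemma plinear_comp: "plinear a \<Longrightarrow> plinear b \<Longrightarrow> plinear (\<lambda>f. a (b f))"
  by (rule plinearI) (simp_all add: plinear_add plinear_scale)

lemma plinear_sum: "(\<And>i. i \<in> I \<Longrightarrow> plinear (b i)) \<Longrightarrow> plinear (\<lambda>f. \<Sum>i\<in>I. b i f)"
  by (rule plinearI) (simp_all add: plinear_add plinear_scale sum.distrib pscale_sum)

abbreviation unit_exp :: "'p \<Rightarrow> 'p monom" where
  "unit_exp p \<equiv> Poly_Mapping.single p 1"

lemma add_minus_unit_exp: "Poly_Mapping.lookup \<mu> p \<noteq> 0 \<Longrightarrow> \<mu> - unit_exp p + unit_exp p = \<mu>"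
  by (rule poly_mapping_eqI) (auto simp: lookup_add lookup_minus lookup_single when_def)

lemma minus_unit_exp_eq_iff:
  "Poly_Mapping.lookup \<mu> p \<noteq> 0 \<Longrightarrow> \<mu> - unit_exp p = \<nu> \<longleftrightarrow> \<mu> = \<nu> + unit_exp p"
  by (metis add_minus_unit_exp add_diff_cancel_right')

lemma var_times_single: "var p * Poly_Mapping.single \<mu> c = Poly_Mapping.single (\<mu> + unit_exp p) c"
  by (simp add: var_def monomial_def mult_single add.commute)

text \<open>Read off coefficient by coefficient, the derivative involves no truncated subtraction of
  exponents.\<close>

lemma lookup_pderiv: "Poly_Mapping.lookup (pderiv p f) \<nu>
    = of_nat (Suc (Poly_Mapping.lookup \<nu> p)) * Poly_Mapping.lookup f (\<nu> + unit_exp p)"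
proof -
  let ?\<mu> = "\<nu> + unit_exp p"
  have "Poly_Mapping.lookup (pderiv p f) \<nu> = (\<Sum>\<mu>\<in>Poly_Mapping.keys f.
     if \<mu> = ?\<mu> then of_nat (Poly_Mapping.lookup ?\<mu> p) * Poly_Mapping.lookup f ?\<mu> else 0)"
    unfolding pderiv_def lookup_sum
  proof (rule sum.cong)
    fix \<mu>
    show "Poly_Mapping.lookup (Poly_Mapping.single (\<mu> - unit_exp p)
        (of_nat (Poly_Mapping.lookup \<mu> p) * Poly_Mapping.lookup f \<mu>)) \<nu> =
      (if \<mu> = ?\<mu> then of_nat (Poly_Mapping.lookup ?\<mu> p) * Poly_Mapping.lookup f ?\<mu> else 0)"
      using minus_unit_exp_eq_iff[of \<mu> p \<nu>]
      by (cases "Poly_Mapping.lookup \<mu> p = 0") (auto simp: lookup_single when_def lookup_add)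
  qed simp
  also have "\<dots> = of_nat (Poly_Mapping.lookup ?\<mu> p) * Poly_Mapping.lookup f ?\<mu>"
    by (simp add: sum.delta in_keys_iff)
  finally show ?thesis by (simp add: lookup_add)
qed

lemma plinear_pderiv: "plinear (pderiv p)"
  by (rule plinearI)
    (auto intro!: poly_mapping_eqI simp: lookup_pscale lookup_pderiv lookup_add algebra_simps)

lemma pderiv_single: "pderiv p (Poly_Mapping.single \<mu> c)
    = Poly_Mapping.single (\<mu> - unit_exp p) (of_nat (Poly_Mapping.lookup \<mu> p) * c)"
  by (cases "c = 0") (simp_all add: pderiv_def)

lemma pderiv_commute: "pderiv p (pderiv q f) = pderiv q (pderiv p f)"
  by (rule poly_mapping_eqI) (auto simp: lookup_pderiv lookup_add lookup_single when_def ac_simps)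

lemma plinear_eqI:
  assumes "plinear a" "plinear b"
    and single: "\<And>\<mu> c. a (Poly_Mapping.single \<mu> c) = b (Poly_Mapping.single \<mu> c)"
  shows "a f = b f"
proof -
  interpret a: Vector_Spaces.linear pscale pscale a by fact
  interpret b: Vector_Spaces.linear pscale pscale b by fact
  have "a (\<Sum>\<mu>\<in>Poly_Mapping.keys f. Poly_Mapping.single \<mu> (Poly_Mapping.lookup f \<mu>))
    = b (\<Sum>\<mu>\<in>Poly_Mapping.keys f. Poly_Mapping.single \<mu> (Poly_Mapping.lookup f \<mu>))"
    by (simp add: a.sum b.sum single)
  then show ?thesis by (simp flip: single_sum_keys)
qed

text \<open>The Weyl algebra relation \<open>[\<partial>\<^sub>p, x\<^sub>q] = \<delta>\<^sub>p\<^sub>q\<close>.\<close>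

lemma pderiv_var_times:
  "pderiv p (var q * f) = (if p = q then f else 0) + var q * pderiv p f"
proof (rule plinear_eqI[of "\<lambda>f. pderiv p (var q * f)"
      "\<lambda>f. (if p = q then f else 0) + var q * pderiv p f"])
  show "plinear (\<lambda>f. pderiv p (var q * f))"
    by (rule plinear_comp[OF plinear_pderiv plinear_times])
  show "plinear (\<lambda>f. (if p = q then f else 0) + var q * pderiv p f)"
    by (rule plinearI) (auto simp: plinear_add[OF plinear_pderiv] plinear_scale[OF plinear_pderiv]
        pscale_simps times_pscale algebra_simps)
next
  fix \<mu> :: "'a monom" and c
  show "pderiv p (var q * Poly_Mapping.single \<mu> c)
    = (if p = q then Poly_Mapping.single \<mu> c else 0) + var q * pderiv p (Poly_Mapping.single \<mu> c)"
  proof (cases "Poly_Mapping.lookup \<mu> p = 0")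
    case True
    then show ?thesis
      by (simp add: var_times_single pderiv_single lookup_add lookup_single when_def)
  next
    case False
    have "\<mu> + unit_exp q - unit_exp p = \<mu> - unit_exp p + unit_exp q"
      using False by (intro poly_mapping_eqI) (auto simp: lookup_add lookup_minus lookup_single when_def)
    moreover have "\<mu> - unit_exp p + unit_exp p = \<mu>"
      using False by (rule add_minus_unit_exp)
    ultimately show ?thesis
      using False by (auto simp: var_times_single pderiv_single lookup_add lookup_single when_def
          distrib_right add.commute[of "_ * c" c] simp flip: single_add)
  qed
qed

locale complex_vector_space = vector_space sc for sc :: "complex \<Rightarrow> 'v::ab_group_add \<Rightarrow> 'v"
begin

abbreviation vlinear :: "('v \<Rightarrow> 'v) \<Rightarrow> bool" where
  "vlinear \<equiv> Vector_Spaces.linear sc sc"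

abbreviation tlinear :: "(('p, 'v) vpoly \<Rightarrow> ('p, 'v) vpoly) \<Rightarrow> bool" where
  "tlinear \<equiv> Vector_Spaces.linear (tscale sc) (tscale sc)"

lemma vlinearI:
  assumes "\<And>v w. a (v + w) = a v + a w" "\<And>c v. a (sc c v) = sc c (a v)"
  shows "vlinear a"
  unfolding Vector_Spaces.linear_iff using assms vector_space_axioms by auto

lemma vlinear_add: "vlinear a \<Longrightarrow> a (v + w) = a v + a w"
  and vlinear_scale: "vlinear a \<Longrightarrow> a (sc c v) = sc c (a v)"
  by (auto simp: Vector_Spaces.linear_iff)

lemma vlinear_comp: "vlinear a \<Longrightarrow> vlinear b \<Longrightarrow> vlinear (\<lambda>v. a (b v))"
  by (rule vlinearI) (simp_all add: vlinear_add vlinear_scale)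

lemma vlinear_id: "vlinear id"
  by (rule vlinearI) simp_all

lemmas lookup_tscale = lookup_tscale[OF vector_space_axioms]
lemmas lookup_tensor = lookup_tensor[OF vector_space_axioms]

sublocale T: vector_space "tscale sc :: complex \<Rightarrow> ('p, 'v) vpoly \<Rightarrow> ('p, 'v) vpoly"
  by (rule vector_space_tscale[OF vector_space_axioms])

lemma tlinearI:
  assumes "\<And>v w. a (v + w) = a v + a w" "\<And>c v. a (tscale sc c v) = tscale sc c (a v)"
  shows "tlinear a"
  unfolding Vector_Spaces.linear_iff using assms T.vector_space_axioms by auto

lemma tlinear_add: "tlinear a \<Longrightarrow> a (v + w) = a v + a w"
  and tlinear_scale: "tlinear a \<Longrightarrow> a (tscale sc c v) = tscale sc c (a v)"
  by (auto simp: Vector_Spaces.linear_iff)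

lemma lookup_op_tensor: "Poly_Mapping.lookup (op_tensor sc a b t) \<nu>
    = (\<Sum>\<mu>\<in>Poly_Mapping.keys t. sc (Poly_Mapping.lookup (b (monomial \<mu>)) \<nu>) (a (Poly_Mapping.lookup t \<mu>)))"
  unfolding op_tensor_def by (simp add: lookup_sum lookup_tensor)

lemma lookup_op_tensor_superset:
  assumes "vlinear a" "finite S" "Poly_Mapping.keys t \<subseteq> S"
  shows "Poly_Mapping.lookup (op_tensor sc a b t) \<nu>
    = (\<Sum>\<mu>\<in>S. sc (Poly_Mapping.lookup (b (monomial \<mu>)) \<nu>) (a (Poly_Mapping.lookup t \<mu>)))"
proof -
  interpret a: Vector_Spaces.linear sc sc a by fact
  show ?thesis
    unfolding lookup_op_tensor using assms
    by (intro sum.mono_neutral_left) (auto simp: in_keys_iff)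
qed

lemma tlinear_op_tensor: assumes a: "vlinear a" shows "tlinear (op_tensor sc a b)"
proof (rule tlinearI; rule poly_mapping_eqI)
  interpret a: Vector_Spaces.linear sc sc a by fact
  fix s t :: "('a, 'v) vpoly" and c \<nu>
  let ?S = "Poly_Mapping.keys s \<union> Poly_Mapping.keys t"
  have "Poly_Mapping.keys (s + t) \<subseteq> ?S" by (rule Poly_Mapping.keys_add)
  then show "Poly_Mapping.lookup (op_tensor sc a b (s + t)) \<nu>
    = Poly_Mapping.lookup (op_tensor sc a b s + op_tensor sc a b t) \<nu>"
    by (simp add: lookup_op_tensor_superset[OF a, of ?S] lookup_add a.add scale_right_distrib sum.distrib)
  have "Poly_Mapping.keys (tscale sc c t) \<subseteq> Poly_Mapping.keys t"
    by (auto simp: in_keys_iff lookup_tscale)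
  then show "Poly_Mapping.lookup (op_tensor sc a b (tscale sc c t)) \<nu>
    = Poly_Mapping.lookup (tscale sc c (op_tensor sc a b t)) \<nu>"
    by (simp add: lookup_op_tensor_superset[OF a, of "Poly_Mapping.keys t"] lookup_tscale a.scale
        scale_sum_right mult.commute)
qed

lemma op_tensor_single: "a 0 = 0 \<Longrightarrow>
    op_tensor sc a b (Poly_Mapping.single \<mu> v) = tensor sc (a v) (b (monomial \<mu>))"
  by (cases "v = 0")
    (auto simp: op_tensor_def intro!: poly_mapping_eqI simp: lookup_tensor)

lemma tlinear_eqI:
  assumes "tlinear a" "tlinear b"
    and single: "\<And>\<mu> v. a (Poly_Mapping.single \<mu> v) = b (Poly_Mapping.single \<mu> v)"
  shows "a t = b t"
proof -
  interpret a: Vector_Spaces.linear "tscale sc" "tscale sc" a by fact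
  interpret b: Vector_Spaces.linear "tscale sc" "tscale sc" b by fact
  have "a (\<Sum>\<mu>\<in>Poly_Mapping.keys t. Poly_Mapping.single \<mu> (Poly_Mapping.lookup t \<mu>))
    = b (\<Sum>\<mu>\<in>Poly_Mapping.keys t. Poly_Mapping.single \<mu> (Poly_Mapping.lookup t \<mu>))"
    by (simp add: a.sum b.sum single)
  then show ?thesis by (simp flip: single_sum_keys)
qed

lemma op_tensor_comp:
  assumes "vlinear a" "vlinear a'" "plinear b" "plinear b'"
  shows "op_tensor sc a b (op_tensor sc a' b' t) = op_tensor sc (\<lambda>v. a (a' v)) (\<lambda>f. b (b' f)) t"
proof (rule tlinear_eqI[of "\<lambda>t. op_tensor sc a b (op_tensor sc a' b' t)"])
  interpret a: Vector_Spaces.linear sc sc a by fact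
  interpret a': Vector_Spaces.linear sc sc a' by fact
  note t = tlinear_op_tensor[OF assms(1)] tlinear_op_tensor[OF assms(2)]
  show "tlinear (\<lambda>t. op_tensor sc a b (op_tensor sc a' b' t))"
    by (rule tlinearI) (simp_all add: tlinear_add[OF t(1)] tlinear_add[OF t(2)]
        tlinear_scale[OF t(1)] tlinear_scale[OF t(2)])
  show "tlinear (op_tensor sc (\<lambda>v. a (a' v)) (\<lambda>f. b (b' f)))"
    by (rule tlinear_op_tensor[OF vlinear_comp[OF assms(1,2)]])
  fix \<mu> :: "'a monom" and v
  show "op_tensor sc a b (op_tensor sc a' b' (Poly_Mapping.single \<mu> v))
      = op_tensor sc (\<lambda>v. a (a' v)) (\<lambda>f. b (b' f)) (Poly_Mapping.single \<mu> v)"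
    by (simp add: op_tensor_single op_tensor_tensor[OF assms(1,3)])
qed

lemma op_tensor_add_left:
  "op_tensor sc (\<lambda>v. a v + a' v) b t = op_tensor sc a b t + op_tensor sc a' b t"
  by (rule poly_mapping_eqI) (simp add: lookup_op_tensor lookup_add scale_right_distrib sum.distrib)

lemma op_tensor_diff_left:
  "op_tensor sc (\<lambda>v. a v - a' v) b t = op_tensor sc a b t - op_tensor sc a' b t"
  by (rule poly_mapping_eqI) (simp add: lookup_op_tensor lookup_minus scale_right_diff_distrib sum_subtractf)

lemma op_tensor_add_right:
  "op_tensor sc a (\<lambda>f. b f + b' f) t = op_tensor sc a b t + op_tensor sc a b' t"
  by (rule poly_mapping_eqI) (simp add: lookup_op_tensor lookup_add scale_left_distrib sum.distrib)

lemma op_tensor_diff_right: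
  "op_tensor sc a (\<lambda>f. b f - b' f) t = op_tensor sc a b t - op_tensor sc a b' t"
  by (rule poly_mapping_eqI) (simp add: lookup_op_tensor lookup_minus scale_left_diff_distrib sum_subtractf)

lemma op_tensor_scale_left:
  "op_tensor sc (\<lambda>v. sc c (a v)) b t = tscale sc c (op_tensor sc a b t)"
  by (rule poly_mapping_eqI) (simp add: lookup_op_tensor lookup_tscale scale_sum_right mult.commute)

lemma op_tensor_scale_right:
  "op_tensor sc a (\<lambda>f. pscale c (b f)) t = tscale sc c (op_tensor sc a b t)"
  by (rule poly_mapping_eqI) (simp add: lookup_op_tensor lookup_tscale lookup_pscale scale_sum_right)

lemma op_tensor_zero: "op_tensor sc (\<lambda>v. 0) b t = 0" "op_tensor sc a (\<lambda>v. 0) t = 0"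
  by (auto intro!: poly_mapping_eqI simp: lookup_op_tensor)

lemma op_tensor_sum_left:
  "op_tensor sc (\<lambda>v. \<Sum>i\<in>I. a i v) b t = (\<Sum>i\<in>I. op_tensor sc (a i) b t)"
  by (induction I rule: infinite_finite_induct) (simp_all add: op_tensor_zero op_tensor_add_left)

lemma op_tensor_sum_right:
  "op_tensor sc a (\<lambda>f. \<Sum>i\<in>I. b i f) t = (\<Sum>i\<in>I. op_tensor sc a (b i) t)"
  by (induction I rule: infinite_finite_induct) (simp_all add: op_tensor_zero op_tensor_add_right)

lemma op_tensor_id: "op_tensor sc id id t = t"
proof (rule tlinear_eqI[of "op_tensor sc id id"])
  show "tlinear (op_tensor sc id id)" by (rule tlinear_op_tensor[OF vlinear_id])
qed (auto intro: tlinearI simp: op_tensor_single tensor_monomial[OF vector_space_axioms])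

end

section \<open>Brackets of odd root vectors\<close>

lemma E_nth: "E i j $ a $ b = (if a = i \<and> b = j then 1 else 0)"
  by (simp add: E_def)

lemma matrix_mult_E: "(X ** E a b) $ r $ s = (if s = b then X $ r $ a else 0)"
  by (simp add: matrix_matrix_mult_def E_def if_distrib[of "(*) _"] cong: if_cong)

lemma E_mult_matrix: "(E a b ** X) $ r $ s = (if r = a then X $ b $ s else 0)"
  by (simp add: matrix_matrix_mult_def E_def if_distrib[of "\<lambda>x. x * _"] cong: if_cong)

lemma mscale_nth: "mscale c X $ a $ b = c * X $ a $ b"
  by (simp add: mscale_def)

lemma gl_component_homogeneous:
  "X \<in> gl_part p \<Longrightarrow> gl_component q X = (if p = q then X else 0)"
  by (auto simp: gl_component_def gl_part_def vec_eq_iff)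

lemma sbracket_homogeneous:
  assumes "X \<in> gl_part p" "Y \<in> gl_part q"
  shows "sbracket X Y = X ** Y - mscale (ksign p q) (Y ** X)"
proof -
  have z: "mscale c 0 = 0" for c by (simp add: mscale_def vec_eq_iff)
  show ?thesis
    unfolding sbracket_def gl_component_homogeneous[OF assms(1)] gl_component_homogeneous[OF assms(2)]
    by (cases p; cases q) (simp_all add: z)
qed

lemma dd_odd: "dd p \<in> gl_part 1" and xx_odd: "xx p \<in> gl_part 1"
  by (auto simp: gl_part_def dd_def xx_def E_nth)

text \<open>The coefficient of \<open>x\<^sub>q\<close> in \<open>[X, x\<^sub>p]\<close>.\<close>

definition ad_coeff :: "('m::finite, 'n::finite) gl \<Rightarrow> 'm \<times> 'n \<Rightarrow> 'm \<times> 'n \<Rightarrow> complex" where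
  "ad_coeff X p q = sbracket X (xx p) $ Inr (snd q) $ Inl (fst q)"

lemma ksign_simps [simp]: "ksign 0 q = 1" "ksign p 0 = 1" "ksign 1 1 = -1"
  by (simp_all add: ksign_def)

lemma sbracket_xx_nth:
  assumes "X \<in> g0"
  shows "sbracket X (xx p) $ r $ s = (if s = Inl (fst p) then X $ r $ Inr (snd p) else 0)
    - (if r = Inr (snd p) then X $ Inl (fst p) $ s else 0)"
  unfolding sbracket_homogeneous[OF assms xx_odd]
  by (simp add: xx_def matrix_mult_E E_mult_matrix mscale_nth)

lemma sbracket_dd_nth:
  assumes "X \<in> g0"
  shows "sbracket X (dd p) $ r $ s = (if s = Inr (snd p) then X $ r $ Inl (fst p) else 0)
    - (if r = Inl (fst p) then X $ Inr (snd p) $ s else 0)"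
  unfolding sbracket_homogeneous[OF assms dd_odd]
  by (simp add: dd_def matrix_mult_E E_mult_matrix mscale_nth)

lemma ad_coeff_even:
  assumes "X \<in> g0"
  shows "ad_coeff X p q = (if fst p = fst q then X $ Inr (snd q) $ Inr (snd p) else 0)
     - (if snd p = snd q then X $ Inl (fst p) $ Inl (fst q) else 0)"
  unfolding ad_coeff_def sbracket_xx_nth[OF assms] by auto

lemma sum_mscale_xx_nth:
  "(\<Sum>q\<in>UNIV. mscale (c q) (xx q)) $ Inr l $ Inl a = c (a, l)"
  "(\<Sum>q\<in>UNIV. mscale (c q) (xx q)) $ Inl b $ s = 0"
  "(\<Sum>q\<in>UNIV. mscale (c q) (xx q)) $ r $ Inr k = 0"
proof -
  have "(\<Sum>q\<in>UNIV. c q * (if l = snd q \<and> a = fst q then 1 else 0)) = (\<Sum>q\<in>{(a, l)}. c q)"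
    by (rule sum.mono_neutral_cong_right) auto
  then show "(\<Sum>q\<in>UNIV. mscale (c q) (xx q)) $ Inr l $ Inl a = c (a, l)"
    by (simp add: mscale_nth xx_def E_nth)
qed (simp_all add: mscale_nth xx_def E_nth)

lemma sum_mscale_dd_nth:
  "(\<Sum>q\<in>UNIV. mscale (c q) (dd q)) $ Inl a $ Inr l = c (a, l)"
  "(\<Sum>q\<in>UNIV. mscale (c q) (dd q)) $ Inr b $ s = 0"
  "(\<Sum>q\<in>UNIV. mscale (c q) (dd q)) $ r $ Inl k = 0"
proof -
  have "(\<Sum>q\<in>UNIV. c q * (if a = fst q \<and> l = snd q then 1 else 0)) = (\<Sum>q\<in>{(a, l)}. c q)"
    by (rule sum.mono_neutral_cong_right) auto
  then show "(\<Sum>q\<in>UNIV. mscale (c q) (dd q)) $ Inl a $ Inr l = c (a, l)"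
    by (simp add: mscale_nth dd_def E_nth)
qed (simp_all add: mscale_nth dd_def E_nth)

lemma gl_eqI:
  assumes "\<And>a b. X $ Inl a $ Inl b = Y $ Inl a $ Inl b" "\<And>a b. X $ Inl a $ Inr b = Y $ Inl a $ Inr b"
    "\<And>a b. X $ Inr a $ Inl b = Y $ Inr a $ Inl b" "\<And>a b. X $ Inr a $ Inr b = Y $ Inr a $ Inr b"
  shows "X = (Y :: ('m::finite, 'n::finite) gl)"
proof -
  have "X $ r $ s = Y $ r $ s" for r s
    using assms by (cases r; cases s) simp_all
  then show ?thesis by (simp add: vec_eq_iff)
qed

lemma g0_nth: "X \<in> g0 \<Longrightarrow> X $ Inl a $ Inr b = 0" "X \<in> g0 \<Longrightarrow> X $ Inr b $ Inl a = 0"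
  by (simp_all add: gl_part_def)

lemma sbracket_even_xx:
  assumes "X \<in> g0" shows "sbracket X (xx p) = (\<Sum>q\<in>UNIV. mscale (ad_coeff X p q) (xx q))"
  by (rule gl_eqI) (simp_all only: sum_mscale_xx_nth,
      simp_all add: ad_coeff_def sbracket_xx_nth g0_nth assms)

text \<open>The invariant pairing \<open>2 B\<close>, for which \<open>\<partial>\<^sub>p\<close> and \<open>x\<^sub>p\<close> are dual bases, makes the matrix of \<open>X\<close>
  on \<open>\<gg>\<^sub>+\<close> the negative transpose of its matrix on \<open>\<gg>\<^sub>-\<close>.\<close>

lemma sbracket_even_dd:
  assumes "X \<in> g0" shows "sbracket X (dd p) = (\<Sum>q\<in>UNIV. mscale (- ad_coeff X q p) (dd q))"
  by (rule gl_eqI) (simp_all only: sum_mscale_dd_nth ad_coeff_even[OF assms],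
      simp_all add: sbracket_dd_nth g0_nth assms)

lemma sbracket_dd_dd: "sbracket (dd p) (dd q) = 0"
  and sbracket_xx_xx: "sbracket (xx p) (xx q) = 0"
  unfolding sbracket_homogeneous[OF dd_odd dd_odd] sbracket_homogeneous[OF xx_odd xx_odd]
  by (auto simp: dd_def xx_def matrix_mult_E mscale_nth vec_eq_iff E_nth)

lemma sbracket_dd_xx:
  "sbracket (dd p) (xx q) = (if snd p = snd q then E (Inl (fst p)) (Inl (fst q)) else 0)
     + (if fst p = fst q then E (Inr (snd q)) (Inr (snd p)) else 0)"
  unfolding sbracket_homogeneous[OF dd_odd xx_odd]
  by (rule gl_eqI) (auto simp: dd_def xx_def matrix_mult_E mscale_nth E_nth)

lemma sbracket_xx_dd:
  "sbracket (xx p) (dd q) = sbracket (dd q) (xx p)"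
  unfolding sbracket_homogeneous[OF dd_odd xx_odd] sbracket_homogeneous[OF xx_odd dd_odd]
  by (simp add: vec_eq_iff mscale_nth)

lemma sbracket_dd_xx_even: "sbracket (dd p) (xx q) \<in> g0"
  unfolding sbracket_dd_xx gl_part_def by (auto simp: E_nth)

lemma gl_decompose: "X = gl_component 0 X + (\<Sum>p\<in>UNIV. mscale (X $ Inl (fst p) $ Inr (snd p)) (dd p))
    + (\<Sum>p\<in>UNIV. mscale (X $ Inr (snd p) $ Inl (fst p)) (xx p))"
  by (rule gl_eqI) (simp_all only: sum_mscale_dd_nth sum_mscale_xx_nth vector_add_component,
    simp_all add: gl_component_def)

lemma gl_component_even: "gl_component 0 X \<in> g0"
  unfolding gl_component_def gl_part_def by (simp only: vec_lambda_beta mem_Collect_eq if_False) simp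


section \<open>The Weil representation is the adjoint action shifted by \<open>-\<rho>\<^sub>1\<close>\<close>

text \<open>By invariance of \<open>B\<close> this number is minus the coefficient of \<open>x\<^sub>p\<close> in \<open>[X, x\<^sub>q]\<close> if \<open>X\<close> is even, which
  gives the quadratic part of \<open>\<alpha>\<close>. The diagonal terms \<open>p = q\<close> are the values of the weights of
  \<open>\<gg>\<^sub>+\<close> on the diagonal of \<open>X\<close>, which gives the scalar part.\<close>

lemma B_sbracket_dd_xx:
  "2 * B X (sbracket (dd p) (xx q)) = (if snd p = snd q then X $ Inl (fst q) $ Inl (fst p) else 0)
     - (if fst p = fst q then X $ Inr (snd p) $ Inr (snd q) else 0)"
  unfolding B_def sbracket_dd_xx
  by (auto simp: matrix_add_ldistrib str_def matrix_mult_E)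

lemma ad_S_eq: "ad_S X f = (\<Sum>p\<in>UNIV. \<Sum>q\<in>UNIV. pscale (ad_coeff X p q) (var q * pderiv p f))"
  unfolding ad_S_def lin_poly_def ad_coeff_def
  by (simp add: sum_distrib_right pscale_eq_times mult.assoc)

text \<open>The vectors \<open>\<partial>\<^sub>p\<close>, \<open>p = (i, k)\<close>, have the pairwise distinct weights \<open>h \<mapsto> h\<^sub>i\<^sub>i - h\<^sub>k\<^sub>k\<close> and form a basis of
  \<open>\<gg>\<^sub>+\<close>, so that the sum over the set \<open>\<Delta>\<^sub>1\<^sup>+\<close> is a sum over all \<open>p\<close>.\<close>

lemma rho1_eq:
  fixes h :: "('m::finite, 'n::finite) gl"
  assumes "h \<in> h0"
  shows "rho1 h = (\<Sum>p\<in>UNIV. h $ Inl (fst p) $ Inl (fst p) - h $ Inr (snd p) $ Inr (snd p)) / 2"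
proof -
  let ?\<beta> = "\<lambda>p. restrict (\<lambda>h :: ('m, 'n) gl. h $ Inl (fst p) $ Inl (fst p) - h $ Inr (snd p) $ Inr (snd p)) h0"
  have h0_even: "h \<in> g0" if "h \<in> h0" for h :: "('m, 'n) gl"
  proof -
    have "h $ a $ b = 0" if "parity a + parity b \<noteq> 0" for a b
      using that \<open>h \<in> h0\<close> by (cases "a = b") (auto simp: h0_def)
    then show ?thesis by (simp add: gl_part_def)
  qed
  have gplus_odd: "Y \<in> gl_part 1" if "Y \<in> gplus" for Y :: "('m, 'n) gl"
  proof -
    have "Y $ a $ b = 0" if "parity a + parity b \<noteq> 1" for a b
      using that \<open>Y \<in> gplus\<close> by (auto simp: gplus_def)
    then show ?thesis by (simp add: gl_part_def)
  qed
  \<comment> \<open>The nonzero entry of a weight vector determines its weight.\<close>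
  have diag: "sbracket h Y $ Inl i $ Inr k = (h $ Inl i $ Inl i - h $ Inr k $ Inr k) * Y $ Inl i $ Inr k"
    if "h \<in> h0" "Y \<in> gplus" for h Y :: "('m, 'n) gl" and i k
  proof -
    have "(h ** Y) $ Inl i $ Inr k = (\<Sum>c\<in>{Inl i}. h $ Inl i $ c * Y $ c $ Inr k)"
      unfolding matrix_matrix_mult_def vec_lambda_beta using that(1)
      by (intro sum.mono_neutral_right) (auto simp: h0_def)
    moreover have "(Y ** h) $ Inl i $ Inr k = (\<Sum>c\<in>{Inr k}. Y $ Inl i $ c * h $ c $ Inr k)"
      unfolding matrix_matrix_mult_def vec_lambda_beta using that(1)
      by (intro sum.mono_neutral_right) (auto simp: h0_def)
    ultimately show ?thesis
      unfolding sbracket_homogeneous[OF h0_even[OF that(1)] gplus_odd[OF that(2)]]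
      by (simp add: mscale_nth algebra_simps)
  qed
  have dd_gplus: "dd p \<in> gplus" for p :: "'m \<times> 'n"
    by (auto simp: gplus_def dd_def E_nth)
  have Delta: "Delta1_plus = range ?\<beta>"
  proof (intro equalityI subsetI)
    fix \<beta> :: "('m, 'n) gl \<Rightarrow> complex" assume "\<beta> \<in> Delta1_plus"
    then obtain Y where ext: "\<beta> \<in> extensional h0" and Y: "Y \<in> gplus" "Y \<noteq> 0"
      and w: "\<forall>h\<in>h0. sbracket h Y = mscale (\<beta> h) Y"
      unfolding Delta1_plus_def by blast
    obtain a b where ab: "Y $ a $ b \<noteq> 0" using Y(2) by (auto simp: vec_eq_iff)
    then have "parity a = 0 \<and> parity b = 1" using Y(1) unfolding gplus_def by blast
    then obtain i k where [simp]: "a = Inl i" "b = Inr k" by (cases a; cases b) auto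
    have "\<beta> h = h $ Inl i $ Inl i - h $ Inr k $ Inr k" if "h \<in> h0" for h
    proof -
      have "\<beta> h * Y $ a $ b = sbracket h Y $ a $ b" using w that by (simp add: mscale_nth)
      then show ?thesis using diag[OF that Y(1), of i k] ab by simp
    qed
    then have "\<beta> = ?\<beta> (i, k)"
      by (intro extensionalityI[OF ext restrict_extensional]) simp
    then show "\<beta> \<in> range ?\<beta>" by blast
  next
    fix \<beta> assume "\<beta> \<in> range ?\<beta>"
    then obtain p where \<beta>: "\<beta> = ?\<beta> p" by blast
    have "dd p \<noteq> 0" by (auto simp: dd_def E_nth vec_eq_iff)
    moreover have "sbracket h (dd p) = mscale (\<beta> h) (dd p)" if h: "h \<in> h0" for h
      using h unfolding \<beta> sbracket_even_dd[OF h0_even[OF h]]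
      by (intro gl_eqI; cases p) (simp_all only: sum_mscale_dd_nth,
        auto simp: mscale_nth ad_coeff_even[OF h0_even[OF h]] dd_def E_nth h0_def)
    ultimately show "\<beta> \<in> Delta1_plus"
      unfolding Delta1_plus_def using dd_gplus[of p] \<beta> by auto
  qed
  have inj: "inj ?\<beta>"
  proof (rule injI)
    fix p q assume eq: "?\<beta> p = ?\<beta> q"
    have E_h0: "E r r \<in> h0" for r :: "'m + 'n" by (auto simp: h0_def E_nth)
    have "fst p = fst q"
      using fun_cong[OF eq, of "E (Inl (fst p)) (Inl (fst p))"] E_h0[of "Inl (fst p)"]
      by (auto simp: E_nth split: if_splits)
    moreover have "snd p = snd q"
      using fun_cong[OF eq, of "E (Inr (snd p)) (Inr (snd p))"] E_h0[of "Inr (snd p)"]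
      by (auto simp: E_nth split: if_splits)
    ultimately show "p = q" by (rule prod_eqI)
  qed
  show ?thesis
    unfolding rho1_def Delta sum.reindex[OF inj] using assms by simp
qed

lemma chi_eq: "chi_minus_rho1 X = - (\<Sum>p\<in>UNIV. B X (sbracket (dd p) (xx p)))"
proof -
  have "diag_part X \<in> h0" by (simp add: diag_part_def h0_def)
  then have "chi_minus_rho1 X
      = - (\<Sum>p\<in>UNIV. X $ Inl (fst p) $ Inl (fst p) - X $ Inr (snd p) $ Inr (snd p)) / 2"
    unfolding chi_minus_rho1_def by (simp add: rho1_eq diag_part_def)
  also have "\<dots> = - (\<Sum>p\<in>UNIV. 2 * B X (sbracket (dd p) (xx p))) / 2"
    unfolding B_sbracket_dd_xx by simp
  also have "\<dots> = - (\<Sum>p\<in>UNIV. B X (sbracket (dd p) (xx p)))"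
    by (simp flip: sum_distrib_left)
  finally show ?thesis .
qed

text \<open>The quadratic part of \<open>\<alpha>(X)\<close> is the derivation extending \<open>x\<^sub>p \<mapsto> [X, x\<^sub>p]\<close>, and its scalar part is
  minus half the sum of the weights of \<open>\<gg>\<^sub>+\<close>.\<close>

lemma alpha_eq_ad_S:
  assumes "X \<in> g0" shows "alpha X f = ad_S X f + pscale (chi_minus_rho1 X) f"
proof -
  have c: "2 * B X (sbracket (xx p) (dd q)) = - ad_coeff X p q" for p q
    unfolding sbracket_xx_dd B_sbracket_dd_xx ad_coeff_even[OF assms] by auto
  have m: "pscale (- c) g = - pscale c g" for c and g :: "('m \<times> 'n) cpoly"
    by (rule poly_mapping_eqI) (simp add: lookup_pscale)
  have s: "pscale (\<Sum>i\<in>I. c i) f = (\<Sum>i\<in>I. pscale (c i) f)" for c and I :: "('m \<times> 'n) set"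
    by (rule poly_mapping_eqI) (simp add: lookup_pscale lookup_sum sum_distrib_right)
  show ?thesis
    unfolding alpha_def ad_S_eq c chi_eq m s by (simp add: sum_negf)
qed

section \<open>Local finiteness\<close>

context complex_vector_space
begin

lemma linear_span_subset:
  assumes "vlinear a" shows "a ` span S \<subseteq> span S' \<longleftrightarrow> a ` S \<subseteq> span S'"
proof -
  interpret a: Vector_Spaces.linear sc sc a by fact
  show ?thesis
    unfolding a.span_image[symmetric] by (metis span_minimal span_superset subset_trans subspace_span)
qed

lemma eq_minus_self: assumes "x = - x" shows "x = (0 :: 'v)"
proof -
  have "sc 2 x = x + x" using scale_left_distrib[of 1 1 x] by simp
  also have "\<dots> = 0" using assms by (metis add.right_inverse)
  finally show ?thesis by simp
qed

text \<open>Anticommuting operators generate a quotient of an exterior algebra, which is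
  finite-dimensional: when the operators are added one at a time, each at most doubles the spanning
  set, and the earlier ones preserve the enlarged span. Minimality of \<open>S'\<close> serves to extend
  properties from \<open>S\<close> to \<open>S'\<close>.\<close>

lemma anticommuting_hull:
  assumes "finite I" and lin: "\<And>i. vlinear (a i)"
    and anti: "\<And>i j v. a i (a j v) = - a j (a i v)" and "finite S"
  shows "\<exists>S'. finite S' \<and> S \<subseteq> S' \<and> (\<forall>i\<in>I. a i ` span S' \<subseteq> span S')
    \<and> (\<forall>T. S \<subseteq> T \<and> (\<forall>i\<in>I. a i ` T \<subseteq> T) \<longrightarrow> S' \<subseteq> T)"
  using assms(1)
proof (induction I)
  case empty
  then show ?case using \<open>finite S\<close> by auto
next
  case (insert j I)
  then obtain S' where S': "finite S'" "S \<subseteq> S'" "\<forall>i\<in>I. a i ` span S' \<subseteq> span S'"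
    "\<forall>T. S \<subseteq> T \<and> (\<forall>i\<in>I. a i ` T \<subseteq> T) \<longrightarrow> S' \<subseteq> T" by blast
  interpret a: Vector_Spaces.linear sc sc "a i" for i by (rule lin)
  let ?S = "S' \<union> a j ` S'"
  have sub: "span S' \<subseteq> span ?S" by (rule span_mono) simp
  have sub_j: "a j ` span S' \<subseteq> span ?S"
    unfolding a.span_image[symmetric] by (rule span_mono) simp
  have "a i x \<in> span ?S" if i: "i \<in> insert j I" and x: "x \<in> ?S" for i x
  proof (cases "x \<in> S'")
    case True
    then have "x \<in> span S'" by (rule span_base)
    then show ?thesis using i S'(3) sub sub_j by blast
  next
    case False
    with x obtain y where y: "y \<in> S'" "x = a j y" by blast
    then have "y \<in> span S'" by (simp add: span_base)
    show ?thesis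
    proof (cases "i = j")
      case True
      then have "a i x = 0" using eq_minus_self anti y(2) by metis
      then show ?thesis by (simp add: span_zero)
    next
      case False
      then have "a i y \<in> span S'" using i S'(3) \<open>y \<in> span S'\<close> by blast
      then have "a j (a i y) \<in> span ?S" using sub_j by blast
      then show ?thesis unfolding y(2) anti[of i j] by (rule span_neg)
    qed
  qed
  then have "\<forall>i\<in>insert j I. a i ` span ?S \<subseteq> span ?S"
    unfolding linear_span_subset[OF lin] by blast
  moreover have "\<forall>T. S \<subseteq> T \<and> (\<forall>i\<in>insert j I. a i ` T \<subseteq> T) \<longrightarrow> ?S \<subseteq> T"
  proof (intro allI impI)
    fix T assume T: "S \<subseteq> T \<and> (\<forall>i\<in>insert j I. a i ` T \<subseteq> T)"
    then have "S' \<subseteq> T" using S'(4) by simp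
    then show "?S \<subseteq> T" using T by blast
  qed
  moreover have "finite ?S" "S \<subseteq> ?S" using S'(1,2) by auto
  ultimately show ?case by (intro exI[of _ ?S] conjI)
qed

end

locale gl_action = complex_vector_space sc
  for sc :: "complex \<Rightarrow> 'v::ab_group_add \<Rightarrow> 'v" +
  fixes \<pi> :: "('m::finite, 'n::finite) gl \<Rightarrow> 'v \<Rightarrow> 'v"
  assumes vlinear_act: "vlinear (\<pi> X)"
    and act_add: "\<pi> (X + Y) v = \<pi> X v + \<pi> Y v"
    and act_mscale: "\<pi> (mscale c X) v = sc c (\<pi> X v)"
    and act_sbracket: "X \<in> gl_part p \<Longrightarrow> Y \<in> gl_part q \<Longrightarrow>
      \<pi> (sbracket X Y) v = \<pi> X (\<pi> Y v) - sc (ksign p q) (\<pi> Y (\<pi> X v))"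
begin

lemma act_zero: "\<pi> 0 v = 0"
  using act_add[of 0 0 v] by simp

lemma act_sum: "\<pi> (\<Sum>q\<in>I. mscale (c q) (Y q)) v = (\<Sum>q\<in>I. sc (c q) (\<pi> (Y q) v))"
  by (induction I rule: infinite_finite_induct) (simp_all add: act_zero act_add act_mscale)

lemma act_even: "X \<in> g0 \<Longrightarrow> Y \<in> gl_part 1 \<Longrightarrow> \<pi> X (\<pi> Y v) = \<pi> Y (\<pi> X v) + \<pi> (sbracket X Y) v"
  using act_sbracket[of X 0 Y 1 v] by simp

lemma act_odd: "X \<in> gl_part 1 \<Longrightarrow> Y \<in> gl_part 1 \<Longrightarrow>
    \<pi> X (\<pi> Y v) = \<pi> (sbracket X Y) v - \<pi> Y (\<pi> X v)"
  using act_sbracket[of X 1 Y 1 v] by simp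

lemma act_dd_anticommute: "\<pi> (dd p) (\<pi> (dd q) v) = - \<pi> (dd q) (\<pi> (dd p) v)"
  and act_xx_anticommute: "\<pi> (xx p) (\<pi> (xx q) v) = - \<pi> (xx q) (\<pi> (xx p) v)"
  using act_odd[OF dd_odd dd_odd, of p q v] act_odd[OF xx_odd xx_odd, of p q v]
  by (simp_all add: sbracket_dd_dd sbracket_xx_xx act_zero)

text \<open>The family \<open>y\<close> stands for either of the bases \<open>\<partial>\<close> and \<open>x\<close>. The hull stays invariant under \<open>\<gg>\<^sub>0\<close>: the vectors
  that \<open>\<gg>\<^sub>0\<close> does not move out of it form a set containing \<open>S\<close> and stable under all \<open>y\<^sub>p\<close>, because
  \<open>X y\<^sub>p v = y\<^sub>p X v + [X, y\<^sub>p] v\<close> and \<open>[X, y\<^sub>p]\<close> is a combination of the \<open>y\<^sub>q\<close>.\<close>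

lemma odd_hull:
  fixes y :: "'m \<times> 'n \<Rightarrow> ('m, 'n) gl"
  assumes odd: "\<And>p. y p \<in> gl_part 1"
    and comm: "\<And>p q. sbracket (y p) (y q) = 0"
    and ad: "\<And>X p. X \<in> g0 \<Longrightarrow> \<exists>c. sbracket X (y p) = (\<Sum>q\<in>UNIV. mscale (c q) (y q))"
    and S: "finite S" "\<forall>X\<in>g0. \<pi> X ` span S \<subseteq> span S"
  obtains S' where "finite S'" "S \<subseteq> S'" "\<forall>p. \<pi> (y p) ` span S' \<subseteq> span S'"
    "\<forall>X\<in>g0. \<pi> X ` span S' \<subseteq> span S'"
    "\<forall>T. S \<subseteq> T \<and> (\<forall>p. \<pi> (y p) ` T \<subseteq> T) \<longrightarrow> S' \<subseteq> T"
proof -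
  have "\<pi> (y p) (\<pi> (y q) v) = - \<pi> (y q) (\<pi> (y p) v)" for p q v
    using act_odd[OF odd odd, of p q v] by (simp add: comm act_zero)
  from anticommuting_hull[of UNIV "\<lambda>p. \<pi> (y p)", OF _ vlinear_act this S(1)]
  obtain S' where S': "finite S'" "S \<subseteq> S'" "\<forall>p. \<pi> (y p) ` span S' \<subseteq> span S'"
    "\<forall>T. S \<subseteq> T \<and> (\<forall>p. \<pi> (y p) ` T \<subseteq> T) \<longrightarrow> S' \<subseteq> T" by auto
  let ?T = "{v \<in> span S'. \<forall>X\<in>g0. \<pi> X v \<in> span S'}"
  have "S \<subseteq> ?T \<and> (\<forall>p. \<pi> (y p) ` ?T \<subseteq> ?T)"
  proof (intro conjI allI)
    have "span S \<subseteq> ?T" using S(2) span_mono[OF S'(2)] by blast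
    then show "S \<subseteq> ?T" using span_superset[of S] by (rule_tac subset_trans)
    show "\<pi> (y p) ` ?T \<subseteq> ?T" for p
    proof safe
      fix v X assume v: "v \<in> span S'" "\<forall>X\<in>g0. \<pi> X v \<in> span S'"
      show "\<pi> (y p) v \<in> span S'" using v(1) S'(3) by blast
      assume X: "X \<in> (g0 :: ('m, 'n) gl set)"
      obtain c where c: "sbracket X (y p) = (\<Sum>q\<in>UNIV. mscale (c q) (y q))"
        using ad[OF X] by blast
      have "\<pi> (y p) (\<pi> X v) \<in> span S'" using v(2) X S'(3) by blast
      moreover have "\<pi> (sbracket X (y p)) v \<in> span S'"
        unfolding c act_sum using v(1) S'(3) by (intro span_sum span_scale) blast
      ultimately show "\<pi> X (\<pi> (y p) v) \<in> span S'"
        unfolding act_even[OF X odd] by (rule span_add)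
    qed
  qed
  then have "S' \<subseteq> ?T" by (rule S'(4)[rule_format])
  then have "\<forall>X\<in>g0. \<pi> X ` span S' \<subseteq> span S'"
    unfolding linear_span_subset[OF vlinear_act] by blast
  then show thesis using S' by (intro that)
qed

definition locally_finite :: "'v set \<Rightarrow> bool" where
  "locally_finite A \<longleftrightarrow> (\<exists>S. finite S \<and> A \<subseteq> span S \<and> (\<forall>X. \<pi> X ` span S \<subseteq> span S))"

text \<open>The reason is \<open>U(\<gg>) = \<Lambda>(\<gg>\<^sub>-) \<Lambda>(\<gg>\<^sub>+) U(\<gg>\<^sub>0)\<close>: the space is closed first under \<open>\<gg>\<^sub>+\<close>, then under
  \<open>\<gg>\<^sub>-\<close>. The second closure preserves invariance under \<open>\<gg>\<^sub>+\<close> since \<open>[\<gg>\<^sub>+, \<gg>\<^sub>-] \<subseteq> \<gg>\<^sub>0\<close>.\<close>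

lemma g0_invariant_locally_finite:
  assumes S: "finite S" "\<forall>X\<in>g0. \<pi> X ` span S \<subseteq> span S"
  shows "locally_finite (span S)"
proof -
  have ad: "\<exists>c. sbracket X (dd p) = (\<Sum>q\<in>UNIV. mscale (c q) (dd q))"
    "\<exists>c. sbracket X (xx p) = (\<Sum>q\<in>UNIV. mscale (c q) (xx q))" if "X \<in> g0"
    for X :: "('m, 'n) gl" and p
    by (rule exI, rule sbracket_even_dd[OF that], rule exI, rule sbracket_even_xx[OF that])
  obtain S1 where S1: "finite S1" "S \<subseteq> S1" "\<forall>p. \<pi> (dd p) ` span S1 \<subseteq> span S1"
    "\<forall>X\<in>g0. \<pi> X ` span S1 \<subseteq> span S1"
    "\<forall>T. S \<subseteq> T \<and> (\<forall>p. \<pi> (dd p) ` T \<subseteq> T) \<longrightarrow> S1 \<subseteq> T"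
    by (rule odd_hull[of dd, OF dd_odd sbracket_dd_dd ad(1) S])
  obtain S2 where S2: "finite S2" "S1 \<subseteq> S2" "\<forall>p. \<pi> (xx p) ` span S2 \<subseteq> span S2"
    "\<forall>X\<in>g0. \<pi> X ` span S2 \<subseteq> span S2"
    "\<forall>T. S1 \<subseteq> T \<and> (\<forall>p. \<pi> (xx p) ` T \<subseteq> T) \<longrightarrow> S2 \<subseteq> T"
    by (rule odd_hull[of xx, OF xx_odd sbracket_xx_xx ad(2) S1(1,4)])
  let ?T = "{v \<in> span S2. \<forall>p. \<pi> (dd p) v \<in> span S2}"
  have "S1 \<subseteq> ?T \<and> (\<forall>p. \<pi> (xx p) ` ?T \<subseteq> ?T)"
  proof (intro conjI allI)
    have "span S1 \<subseteq> ?T" using S1(3) span_mono[OF S2(2)] by blast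
    then show "S1 \<subseteq> ?T" using span_superset[of S1] by (rule_tac subset_trans)
    show "\<pi> (xx p) ` ?T \<subseteq> ?T" for p
    proof safe
      fix v q assume v: "v \<in> span S2" "\<forall>p. \<pi> (dd p) v \<in> span S2"
      show "\<pi> (xx p) v \<in> span S2" using v(1) S2(3) by blast
      have "\<pi> (xx p) (\<pi> (dd q) v) \<in> span S2" using v(2) S2(3) by blast
      moreover have "\<pi> (sbracket (dd q) (xx p)) v \<in> span S2"
        using v(1) S2(4)[rule_format, OF sbracket_dd_xx_even] by blast
      ultimately show "\<pi> (dd q) (\<pi> (xx p) v) \<in> span S2"
        unfolding act_odd[OF dd_odd xx_odd] by (simp add: span_diff)
    qed
  qed
  then have "S2 \<subseteq> ?T" by (rule S2(5)[rule_format])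
  then have dd2: "\<pi> (dd p) ` span S2 \<subseteq> span S2" for p
    unfolding linear_span_subset[OF vlinear_act] by blast
  have "\<pi> X v \<in> span S2" if v: "v \<in> span S2" for X v
  proof -
    have "\<pi> (gl_component 0 X) v \<in> span S2" using S2(4)[rule_format, OF gl_component_even] v by blast
    moreover have "(\<Sum>p\<in>UNIV. sc (X $ Inl (fst p) $ Inr (snd p)) (\<pi> (dd p) v)) \<in> span S2"
      using dd2 v by (intro span_sum span_scale) blast
    moreover have "(\<Sum>p\<in>UNIV. sc (X $ Inr (snd p) $ Inl (fst p)) (\<pi> (xx p) v)) \<in> span S2"
      using S2(3) v by (intro span_sum span_scale) blast
    ultimately show ?thesis
      by (subst gl_decompose) (simp only: act_add act_sum span_add)
  qed
  then show ?thesis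
    unfolding locally_finite_def using S2(1) span_mono[OF subset_trans[OF S1(2) S2(2)]] by blast
qed

lemma locally_finite_Un:
  assumes "locally_finite A" "locally_finite A'" shows "locally_finite (A \<union> A')"
proof -
  obtain S S' where S: "finite S" "A \<subseteq> span S" "\<And>X. \<pi> X ` span S \<subseteq> span S"
    and S': "finite S'" "A' \<subseteq> span S'" "\<And>X. \<pi> X ` span S' \<subseteq> span S'"
    using assms unfolding locally_finite_def by blast
  have sub: "span S \<subseteq> span (S \<union> S')" "span S' \<subseteq> span (S \<union> S')"
    by (rule span_mono, simp)+
  have "\<pi> X ` (S \<union> S') \<subseteq> span (S \<union> S')" for X
    using S(3)[of X] S'(3)[of X] sub span_superset[of S] span_superset[of S'] by blast
  then have "\<pi> X ` span (S \<union> S') \<subseteq> span (S \<union> S')" for X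
    unfolding linear_span_subset[OF vlinear_act] .
  then show ?thesis
    unfolding locally_finite_def using S(1,2) S'(1,2) sub by (intro exI[of _ "S \<union> S'"]) auto
qed

lemma locally_finite_Union:
  assumes "finite I" "\<And>i. i \<in> I \<Longrightarrow> locally_finite (A i)" shows "locally_finite (\<Union>i\<in>I. A i)"
  using assms
proof (induction I)
  case empty
  have "\<pi> X ` span {} \<subseteq> span {}" for X unfolding linear_span_subset[OF vlinear_act] by simp
  then show ?case unfolding locally_finite_def by (intro exI[of _ "{}"]) auto
next
  case (insert i I)
  then show ?case using locally_finite_Un[of "A i"] by simp
qed

lemma locally_finite_span: "locally_finite A \<Longrightarrow> locally_finite (span A)"
  unfolding locally_finite_def by (meson span_minimal subspace_span)

lemma locally_finite_mono: "locally_finite A \<Longrightarrow> A' \<subseteq> A \<Longrightarrow> locally_finite A'"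
  unfolding locally_finite_def by blast

lemma locally_finite_direct_sum:
  assumes sum: "is_direct_sum \<W> (\<lambda>W. W) UNIV"
    and W: "\<And>W. W \<in> \<W> \<Longrightarrow> g0_submodule sc \<pi> W \<and> (\<exists>S. finite S \<and> span S = W)"
    and "finite A"
  shows "locally_finite A"
proof -
  have "locally_finite {v}" for v
  proof -
    have "v \<in> (\<lambda>f. \<Sum>i | f i \<noteq> 0. f i) ` {f. finite {i. f i \<noteq> 0} \<and> (\<forall>W\<in>\<W>. f W \<in> W) \<and> (\<forall>W. W \<notin> \<W> \<longrightarrow> f W = 0)}"
      using sum unfolding is_direct_sum_def bij_betw_def by simp
    then obtain f where f: "finite {W. f W \<noteq> 0}" "\<forall>W\<in>\<W>. f W \<in> W" "\<forall>W. W \<notin> \<W> \<longrightarrow> f W = 0"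
      "v = (\<Sum>W | f W \<noteq> 0. f W)" by blast
    have "locally_finite W" if "W \<in> \<W>" for W
      using W[OF that] g0_invariant_locally_finite unfolding g0_submodule_def by auto
    then have "locally_finite (\<Union>W\<in>{W. f W \<noteq> 0}. W)"
      using f(1,3) by (intro locally_finite_Union) auto
    then have "locally_finite (span (\<Union>W\<in>{W. f W \<noteq> 0}. W))" by (rule locally_finite_span)
    moreover have "v \<in> span (\<Union>W\<in>{W. f W \<noteq> 0}. W)"
      unfolding f(4) using f(2,3) by (intro span_sum span_base) blast
    ultimately show ?thesis by (rule_tac locally_finite_mono) auto
  qed
  then have "locally_finite (\<Union>v\<in>A. {v})" using \<open>finite A\<close> by (intro locally_finite_Union)
  then show ?thesis by simp
qed

end

section \<open>The Fischer form\<close>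

abbreviation deg :: "'p::finite monom \<Rightarrow> nat" where
  "deg \<mu> \<equiv> \<Sum>p\<in>UNIV. Poly_Mapping.lookup \<mu> p"

lemma deg_add_unit_exp: "deg (\<mu> + unit_exp p) = Suc (deg \<mu>)"
proof -
  have "deg (\<mu> + unit_exp p) = deg \<mu> + (\<Sum>q\<in>UNIV. if q = p then 1 else 0)"
    by (simp add: lookup_add sum.distrib lookup_single when_def eq_commute)
  then show ?thesis by simp
qed

lemma deg_minus_unit_exp: "Poly_Mapping.lookup \<mu> p \<noteq> 0 \<Longrightarrow> Suc (deg (\<mu> - unit_exp p)) = deg \<mu>"
  by (metis add_minus_unit_exp deg_add_unit_exp)

lemma finite_deg_less: "finite {\<mu> :: 'p::finite monom. deg \<mu> < k}"
proof -
  have "Poly_Mapping.lookup ` {\<mu> :: 'p monom. deg \<mu> < k} \<subseteq> PiE UNIV (\<lambda>_. {..<k})"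
  proof (rule image_subsetI)
    fix \<mu> :: "'p monom" assume "\<mu> \<in> {\<mu>. deg \<mu> < k}"
    then have k: "deg \<mu> < k" by simp
    have "Poly_Mapping.lookup \<mu> p \<le> deg \<mu>" for p by (rule member_le_sum) simp_all
    then have "Poly_Mapping.lookup \<mu> p < k" for p using k by (rule le_less_trans)
    then show "Poly_Mapping.lookup \<mu> \<in> PiE UNIV (\<lambda>_. {..<k})" by (simp add: PiE_iff)
  qed
  then have "finite (Poly_Mapping.lookup ` {\<mu> :: 'p monom. deg \<mu> < k})"
    by (rule finite_subset) (simp add: finite_PiE)
  then show ?thesis
    by (rule finite_imageD) (simp add: inj_on_def Poly_Mapping.lookup_inject)
qed

definition monom_fact :: "'p::finite monom \<Rightarrow> nat" where
  "monom_fact \<mu> = (\<Prod>p\<in>UNIV. fact (Poly_Mapping.lookup \<mu> p))"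

lemma monom_fact_pos: "monom_fact \<mu> > 0"
  by (simp add: monom_fact_def prod_pos)

lemma monom_fact_add_unit_exp:
  "monom_fact (\<mu> + unit_exp p) = Suc (Poly_Mapping.lookup \<mu> p) * monom_fact \<mu>"
proof -
  have "monom_fact (\<mu> + unit_exp p)
      = (\<Prod>q\<in>UNIV. (if q = p then Suc (Poly_Mapping.lookup \<mu> p) else 1) * fact (Poly_Mapping.lookup \<mu> q))"
    unfolding monom_fact_def
    by (rule prod.cong) (auto simp: lookup_add lookup_single when_def)
  then show ?thesis by (simp add: prod.distrib monom_fact_def)
qed

text \<open>The Fischer inner product with values of \<open>H\<close> as coefficients: distinct monomials are orthogonal and
  \<open>x\<^sup>\<mu>\<close> has squared norm \<open>\<mu>!\<close>.\<close>

definition fischer :: "('v \<Rightarrow> 'v \<Rightarrow> complex) \<Rightarrow> ('p::finite, 'v::zero) vpoly \<Rightarrow> ('p, 'v) vpoly \<Rightarrow> complex" where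
  "fischer H s t = (\<Sum>\<mu>\<in>Poly_Mapping.keys s.
     of_nat (monom_fact \<mu>) * H (Poly_Mapping.lookup s \<mu>) (Poly_Mapping.lookup t \<mu>))"

context complex_vector_space
begin

lemma lookup_op_tensor_var:
  assumes "vlinear a"
  shows "Poly_Mapping.lookup (op_tensor sc a ((*) (var p)) t) \<nu>
    = (if Poly_Mapping.lookup \<nu> p = 0 then 0 else a (Poly_Mapping.lookup t (\<nu> - unit_exp p)))"
proof -
  interpret a: Vector_Spaces.linear sc sc a by fact
  have c: "Poly_Mapping.lookup (var p * monomial \<mu>) \<nu>
      = (if Poly_Mapping.lookup \<nu> p \<noteq> 0 \<and> \<mu> = \<nu> - unit_exp p then 1 else 0)" for \<mu>
    unfolding monomial_def var_times_single
    using minus_unit_exp_eq_iff[of \<nu> p \<mu>]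
    by (auto simp: lookup_single when_def lookup_add)
  have z: "a (Poly_Mapping.lookup t \<mu>) = 0" if "\<mu> \<notin> Poly_Mapping.keys t" for \<mu>
    using that by (simp add: in_keys_iff)
  show ?thesis
    unfolding lookup_op_tensor c using z
    by (simp add: if_distrib[of "\<lambda>x. sc x _"] sum.delta' sum.delta cong: if_cong)
qed

lemma lookup_op_tensor_pderiv:
  assumes "vlinear a"
  shows "Poly_Mapping.lookup (op_tensor sc a (pderiv p) t) \<nu>
    = sc (of_nat (Suc (Poly_Mapping.lookup \<nu> p))) (a (Poly_Mapping.lookup t (\<nu> + unit_exp p)))"
proof -
  interpret a: Vector_Spaces.linear sc sc a by fact
  have c: "Poly_Mapping.lookup (pderiv p (monomial \<mu>)) \<nu>
      = (if \<mu> = \<nu> + unit_exp p then of_nat (Suc (Poly_Mapping.lookup \<nu> p)) else 0)" for \<mu>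
    unfolding lookup_pderiv monomial_def by (simp add: lookup_single when_def)
  have z: "a (Poly_Mapping.lookup t \<mu>) = 0" if "\<mu> \<notin> Poly_Mapping.keys t" for \<mu>
    using that by (simp add: in_keys_iff)
  show ?thesis
    unfolding lookup_op_tensor c using z
    by (simp add: if_distrib[of "\<lambda>x. sc x _"] sum.delta del: of_nat_Suc cong: if_cong)
qed

context
  fixes H :: "'v \<Rightarrow> 'v \<Rightarrow> complex"
  assumes herm: "pos_def_hermitian sc H"
begin

lemma form_cnj: "H v w = cnj (H w v)"
  using herm unfolding pos_def_hermitian_def by blast

lemma form_simps:
  "H (u + v) w = H u w + H v w" "H (sc c v) w = c * H v w" "H 0 w = 0" "H w 0 = 0"
proof -
  show *: "H (u + v) w = H u w + H v w" for u v w
    using herm unfolding pos_def_hermitian_def by blast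
  show "H (sc c v) w = c * H v w"
    using herm unfolding pos_def_hermitian_def by blast
  show "H 0 w = 0" for w using *[of 0 0 w] by simp
  then show "H w 0 = 0" using form_cnj[of w 0] by simp
qed

lemma fischer_superset:
  assumes "finite S" "Poly_Mapping.keys s \<subseteq> S"
  shows "fischer H s t
    = (\<Sum>\<mu>\<in>S. of_nat (monom_fact \<mu>) * H (Poly_Mapping.lookup s \<mu>) (Poly_Mapping.lookup t \<mu>))"
  unfolding fischer_def using assms
  by (intro sum.mono_neutral_left) (auto simp: in_keys_iff form_simps)

lemma fischer_pos_def: "pos_def_hermitian (tscale sc) (fischer H :: ('p::finite, 'v) vpoly \<Rightarrow> _)"
  unfolding pos_def_hermitian_def
proof (intro conjI allI impI)
  fix u v w :: "('p, 'v) vpoly" and c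
  have "Poly_Mapping.keys (u + v) \<subseteq> Poly_Mapping.keys u \<union> Poly_Mapping.keys v"
    by (rule Poly_Mapping.keys_add)
  then show "fischer H (u + v) w = fischer H u w + fischer H v w"
    by (simp add: fischer_superset[of "Poly_Mapping.keys u \<union> Poly_Mapping.keys v"]
        lookup_add form_simps distrib_left sum.distrib)
  have "Poly_Mapping.keys (tscale sc c v) \<subseteq> Poly_Mapping.keys v"
    by (auto simp: in_keys_iff lookup_tscale)
  then show "fischer H (tscale sc c v) w = c * fischer H v w"
    by (simp add: fischer_superset[of "Poly_Mapping.keys v"] lookup_tscale form_simps
        sum_distrib_left ac_simps)
  let ?S = "Poly_Mapping.keys v \<union> Poly_Mapping.keys w"
  show "fischer H w v = cnj (fischer H v w)"
    unfolding fischer_superset[of ?S w, OF finite_UnI[OF finite_keys finite_keys] Un_upper2]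
      fischer_superset[of ?S v, OF finite_UnI[OF finite_keys finite_keys] Un_upper1] cnj_sum
    by (rule sum.cong) (simp_all flip: form_cnj)
next
  fix t :: "('p, 'v) vpoly" assume "t \<noteq> 0"
  then obtain \<nu> where \<nu>: "\<nu> \<in> Poly_Mapping.keys t"
    by (metis in_keys_iff lookup_zero poly_mapping_eqI)
  have pos: "H v v \<in> \<real>" "Re (H v v) > 0" if "v \<noteq> 0" for v
    using herm that unfolding pos_def_hermitian_def by blast+
  have "H (Poly_Mapping.lookup t \<mu>) (Poly_Mapping.lookup t \<mu>) \<in> \<real>" if "\<mu> \<in> Poly_Mapping.keys t" for \<mu>
    using pos(1) that by (simp add: in_keys_iff)
  then show "fischer H t t \<in> \<real>"
    unfolding fischer_def by (intro sum_in_Reals Reals_mult) auto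
  have "Re (of_nat (monom_fact \<mu>) * H (Poly_Mapping.lookup t \<mu>) (Poly_Mapping.lookup t \<mu>)) > 0"
    if "\<mu> \<in> Poly_Mapping.keys t" for \<mu>
    using pos(2)[of "Poly_Mapping.lookup t \<mu>"] that monom_fact_pos[of \<mu>] by (simp add: in_keys_iff)
  then show "Re (fischer H t t) > 0"
    unfolding fischer_def Re_sum using \<nu> by (intro sum_pos) auto
qed

text \<open>The factor that \<open>\<partial>/\<partial>x\<^sub>p\<close> produces on \<open>x\<^bsup>\<mu> + e\<^esup>\<close>, \<open>e\<close> the exponent of \<open>x\<^sub>p\<close>, is the quotient
  \<open>\<mu>\<^sub>p + 1\<close> of the squared norms \<open>(\<mu> + e)!\<close> and \<open>\<mu>!\<close>.\<close>

lemma fischer_adjoint: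
  assumes lin: "vlinear a" "vlinear a'" and adj: "\<And>v w. H (a v) w = H v (a' w)"
  shows "fischer H (op_tensor sc a ((*) (var p)) s) t = fischer H s (op_tensor sc a' (pderiv p) t)"
proof -
  let ?f = "\<lambda>\<mu>. \<mu> + unit_exp p"
  let ?s = "op_tensor sc a ((*) (var p)) s"
  interpret a: Vector_Spaces.linear sc sc a by (rule lin)
  have H_scale: "H v (sc (of_nat k) w) = of_nat k * H v w" for v w k
    using form_cnj[of v "sc (of_nat k) w"] form_cnj[of v w] by (simp add: form_simps)
  have "Poly_Mapping.keys ?s \<subseteq> ?f ` Poly_Mapping.keys s"
  proof
    fix \<nu> assume "\<nu> \<in> Poly_Mapping.keys ?s"
    then have "Poly_Mapping.lookup \<nu> p \<noteq> 0" "\<nu> - unit_exp p \<in> Poly_Mapping.keys s"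
      using lin(1) by (auto simp: in_keys_iff lookup_op_tensor_var split: if_splits)
    then show "\<nu> \<in> ?f ` Poly_Mapping.keys s"
      using add_minus_unit_exp[of \<nu> p] by (metis image_eqI)
  qed
  then have "fischer H ?s t = (\<Sum>\<nu>\<in>?f ` Poly_Mapping.keys s.
      of_nat (monom_fact \<nu>) * H (Poly_Mapping.lookup ?s \<nu>) (Poly_Mapping.lookup t \<nu>))"
    by (intro fischer_superset) auto
  also have "\<dots> = (\<Sum>\<mu>\<in>Poly_Mapping.keys s.
      of_nat (monom_fact (?f \<mu>)) * H (a (Poly_Mapping.lookup s \<mu>)) (Poly_Mapping.lookup t (?f \<mu>)))"
    by (subst sum.reindex) (auto simp: inj_on_def lookup_op_tensor_var[OF lin(1)] lookup_add)
  also have "\<dots> = fischer H s (op_tensor sc a' (pderiv p) t)"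
    unfolding fischer_def lookup_op_tensor_pderiv[OF lin(2)] H_scale adj monom_fact_add_unit_exp
    by (simp add: algebra_simps)
  finally show ?thesis .
qed

end

section \<open>Homogeneous components\<close>

definition hcomp :: "nat \<Rightarrow> ('p::finite, 'v) vpoly \<Rightarrow> ('p, 'v) vpoly" where
  "hcomp i t = (\<Sum>\<mu>\<in>{\<mu>\<in>Poly_Mapping.keys t. deg \<mu> = i}. Poly_Mapping.single \<mu> (Poly_Mapping.lookup t \<mu>))"

lemma lookup_hcomp: "Poly_Mapping.lookup (hcomp i t) \<mu> = (if deg \<mu> = i then Poly_Mapping.lookup t \<mu> else 0)"
proof -
  have "Poly_Mapping.lookup (hcomp i t) \<mu>
      = (\<Sum>\<nu>\<in>{\<nu>\<in>Poly_Mapping.keys t. deg \<nu> = i}. if \<nu> = \<mu> then Poly_Mapping.lookup t \<mu> else 0)"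
    unfolding hcomp_def lookup_sum by (rule sum.cong) (auto simp: lookup_single when_def)
  then show ?thesis by (simp add: in_keys_iff)
qed

lemma vhom_iff: "t \<in> vhom i \<longleftrightarrow> (\<forall>\<mu>. deg \<mu> \<noteq> i \<longrightarrow> Poly_Mapping.lookup t \<mu> = 0)"
  by (auto simp: vhom_def in_keys_iff)

lemma hcomp_in_vhom: "hcomp i t \<in> vhom i"
  by (simp add: vhom_iff lookup_hcomp)

lemma hcomp_vhom: "t \<in> vhom i \<Longrightarrow> hcomp j t = (if i = j then t else 0)"
  by (rule poly_mapping_eqI) (auto simp: vhom_iff lookup_hcomp)

lemma hcomp_add: "hcomp i (s + t) = hcomp i s + hcomp i t"
  and hcomp_tscale: "hcomp i (tscale sc c t) = tscale sc c (hcomp i t)"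
  and hcomp_zero: "hcomp i 0 = 0"
  by (auto intro!: poly_mapping_eqI simp: lookup_hcomp lookup_add lookup_minus lookup_tscale)

lemma hcomp_sum: "hcomp i (\<Sum>j\<in>J. f j) = (\<Sum>j\<in>J. hcomp i (f j))"
  by (induction J rule: infinite_finite_induct) (simp_all add: hcomp_add hcomp_zero)

lemma finite_hcomp: "finite {i. hcomp i t \<noteq> 0}"
proof (rule finite_subset)
  show "{i. hcomp i t \<noteq> 0} \<subseteq> deg ` Poly_Mapping.keys t"
  proof safe
    fix i assume "hcomp i t \<noteq> 0"
    then obtain \<mu> where "Poly_Mapping.lookup (hcomp i t) \<mu> \<noteq> 0"
      by (metis lookup_zero poly_mapping_eqI)
    then show "i \<in> deg ` Poly_Mapping.keys t"
      by (auto simp: lookup_hcomp in_keys_iff split: if_splits)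
  qed
qed simp

lemma hcomp_eqI: "(\<And>i. hcomp i s = hcomp i t) \<Longrightarrow> s = t"
  by (rule poly_mapping_eqI) (metis lookup_hcomp)

lemma subspace_vhom: "T.subspace (vhom i)"
  by (auto simp: T.subspace_def vhom_iff lookup_add lookup_tscale)

end

section \<open>The differentials\<close>

lemma plinear_ad_S: "plinear (ad_S X)"
  unfolding ad_S_def by (intro plinear_sum plinear_comp[OF plinear_times plinear_pderiv])

lemma ad_S_var_times:
  "ad_S X (var i * f) = var i * ad_S X f + (\<Sum>q\<in>UNIV. pscale (ad_coeff X i q) (var q * f))"
proof -
  have 1: "pscale c (var q * pderiv p (var i * f))
    = (if p = i then pscale c (var q * f) else 0) + var i * pscale c (var q * pderiv p f)" for c p q
    by (cases "p = i") (simp_all add: pderiv_var_times distrib_left pscale_simps times_pscale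
        mult.left_commute[of "var q" "var i"])
  have 2: "(\<Sum>q\<in>UNIV. if p = i then pscale (ad_coeff X p q) (var q * f) else 0)
    = (if p = i then \<Sum>q\<in>UNIV. pscale (ad_coeff X i q) (var q * f) else 0)" for p
    by simp
  show ?thesis
    unfolding ad_S_eq 1 sum.distrib 2 by (simp add: sum_distrib_left add.commute)
qed

lemma pderiv_ad_S:
  "pderiv i (ad_S X f) = ad_S X (pderiv i f) + (\<Sum>p\<in>UNIV. pscale (ad_coeff X p i) (pderiv p f))"
proof -
  interpret D: Vector_Spaces.linear pscale pscale "pderiv i" by (rule plinear_pderiv)
  have 1: "pderiv i (pscale c (var q * pderiv p f))
    = (if q = i then pscale c (pderiv p f) else 0) + pscale c (var q * pderiv p (pderiv i f))" for c p q
    by (simp add: D.scale pderiv_var_times pscale_simps pderiv_commute[of i p])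
  show ?thesis
    unfolding ad_S_eq D.sum 1 sum.distrib by (simp add: add.commute)
qed

context complex_vector_space
begin

lemma tlinear_sum: "(\<And>i. tlinear (f i)) \<Longrightarrow> tlinear (\<lambda>t. \<Sum>i\<in>I. f i t)"
  by (rule tlinearI) (simp_all add: tlinear_add tlinear_scale sum.distrib T.scale_sum_right)

text \<open>With anticommuting operators on one factor and commuting ones on the other, each term of the
  square is cancelled by its transpose.\<close>

lemma sum_op_tensor_squared:
  assumes lin: "\<And>i. vlinear (a i)" "\<And>i. plinear (b i)"
    and anti: "\<And>i j v. a i (a j v) = - a j (a i v)"
    and comm: "\<And>i j f. b i (b j f) = b j (b i f)"
  shows "(\<Sum>i\<in>I. op_tensor sc (a i) (b i) (\<Sum>j\<in>I. op_tensor sc (a j) (b j) t)) = 0"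
proof -
  interpret L: Vector_Spaces.linear "tscale sc" "tscale sc" "op_tensor sc (a i) (b i)" for i
    by (rule tlinear_op_tensor[OF lin(1)])
  let ?A = "\<lambda>i j. op_tensor sc (\<lambda>v. a i (a j v)) (\<lambda>f. b i (b j f)) t"
  have swap: "?A i j = - ?A j i" for i j
    by (rule poly_mapping_eqI)
      (simp add: lookup_op_tensor anti[of i j] comm[of i j] scale_minus_right sum_negf)
  have "(\<Sum>i\<in>I. \<Sum>j\<in>I. ?A i j) = (\<Sum>j\<in>I. \<Sum>i\<in>I. ?A i j)" by (rule sum.swap)
  also have "\<dots> = - (\<Sum>i\<in>I. \<Sum>j\<in>I. ?A i j)"
    by (subst swap) (simp add: sum_negf)
  finally have self: "(\<Sum>i\<in>I. \<Sum>j\<in>I. ?A i j) = - (\<Sum>i\<in>I. \<Sum>j\<in>I. ?A i j)" .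
  have "(\<Sum>i\<in>I. \<Sum>j\<in>I. ?A i j) = 0"
  proof (rule poly_mapping_eqI)
    fix \<nu>
    show "Poly_Mapping.lookup (\<Sum>i\<in>I. \<Sum>j\<in>I. ?A i j) \<nu> = Poly_Mapping.lookup 0 \<nu>"
      using arg_cong[OF self, of "\<lambda>t. Poly_Mapping.lookup t \<nu>"] by (simp add: eq_minus_self)
  qed
  then show ?thesis by (simp add: L.sum op_tensor_comp lin)
qed

end

context gl_action
begin

abbreviation d where "d \<equiv> d_op sc \<pi>"
abbreviation \<delta> where "\<delta> \<equiv> delta_op sc \<pi>"

lemma tlinear_d: "tlinear d" and tlinear_\<delta>: "tlinear \<delta>"
  unfolding d_op_def delta_op_def by (intro tlinear_sum tlinear_op_tensor vlinear_act)+

lemma d_squared: "d (d t) = 0"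
  unfolding d_op_def
  by (rule sum_op_tensor_squared)
    (rule vlinear_act plinear_times act_dd_anticommute mult.left_commute)+

lemma \<delta>_squared: "\<delta> (\<delta> t) = 0"
  unfolding delta_op_def
  by (rule sum_op_tensor_squared)
    (rule vlinear_act plinear_pderiv act_xx_anticommute pderiv_commute)+

lemma D_op_eq: "D_op sc \<pi> t = tscale sc 2 (d t - \<delta> t)"
  unfolding D_op_def d_op_def delta_op_def by (simp add: sum_subtractf)

lemma lookup_d: "Poly_Mapping.lookup (d t) \<nu> = (\<Sum>p\<in>UNIV. if Poly_Mapping.lookup \<nu> p = 0 then 0
    else \<pi> (dd p) (Poly_Mapping.lookup t (\<nu> - unit_exp p)))"
  unfolding d_op_def lookup_sum lookup_op_tensor_var[OF vlinear_act] ..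

lemma lookup_\<delta>: "Poly_Mapping.lookup (\<delta> t) \<nu> = (\<Sum>p\<in>UNIV.
    sc (of_nat (Suc (Poly_Mapping.lookup \<nu> p))) (\<pi> (xx p) (Poly_Mapping.lookup t (\<nu> + unit_exp p))))"
  unfolding delta_op_def lookup_sum lookup_op_tensor_pderiv[OF vlinear_act] ..

lemma act_v_zero [simp]: "\<pi> X 0 = 0"
proof -
  interpret X: Vector_Spaces.linear sc sc "\<pi> X" by (rule vlinear_act)
  show ?thesis by (rule X.zero)
qed

lemma hcomp_d_Suc: "hcomp (Suc i) (d t) = d (hcomp i t)"
proof (rule poly_mapping_eqI)
  fix \<nu> :: "('m \<times> 'n) monom"
  have "(if Poly_Mapping.lookup \<nu> p = 0 then 0
      else \<pi> (dd p) (Poly_Mapping.lookup (hcomp i t) (\<nu> - unit_exp p)))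
    = (if deg \<nu> = Suc i then if Poly_Mapping.lookup \<nu> p = 0 then 0
        else \<pi> (dd p) (Poly_Mapping.lookup t (\<nu> - unit_exp p)) else 0)" for p
  proof (cases "Poly_Mapping.lookup \<nu> p = 0")
    case False
    from deg_minus_unit_exp[OF this] have "(deg \<nu> = Suc i) = (deg (\<nu> - unit_exp p) = i)" by arith
    with False show ?thesis by (simp add: lookup_hcomp del: One_nat_def)
  qed simp
  then show "Poly_Mapping.lookup (hcomp (Suc i) (d t)) \<nu> = Poly_Mapping.lookup (d (hcomp i t)) \<nu>"
    by (simp only: lookup_d lookup_hcomp[of "Suc i"]) simp
qed

lemma hcomp_d_0: "hcomp 0 (d t) = 0"
proof (rule poly_mapping_eqI)
  fix \<nu> :: "('m \<times> 'n) monom"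
  have "Poly_Mapping.lookup (d t) \<nu> = 0" if "deg \<nu> = 0"
    unfolding lookup_d using that by (intro sum.neutral) simp
  then show "Poly_Mapping.lookup (hcomp 0 (d t)) \<nu> = Poly_Mapping.lookup 0 \<nu>"
    unfolding lookup_hcomp by simp
qed

lemma hcomp_\<delta>: "hcomp i (\<delta> t) = \<delta> (hcomp (Suc i) t)"
  by (rule poly_mapping_eqI) (simp add: lookup_hcomp lookup_\<delta> deg_add_unit_exp del: One_nat_def)

lemma \<delta>_hcomp_0: "\<delta> (hcomp 0 t) = 0"
  by (rule poly_mapping_eqI) (simp add: lookup_hcomp lookup_\<delta> deg_add_unit_exp del: One_nat_def)

text \<open>The Laplacian preserves the degree, so that it acts on the finite-dimensional spaces
  \<open>U \<otimes> S\<^bsup>\<le>k\<^esup>\<close> with \<open>U\<close> a finite-dimensional submodule.\<close>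

lemma laplacian_locally_finite:
  assumes "\<And>A. finite A \<Longrightarrow> locally_finite A"
  shows "\<exists>F S. T.subspace F \<and> finite S \<and> F \<subseteq> T.span S \<and> t \<in> F \<and> (\<lambda>s. d (\<delta> s) + \<delta> (d s)) ` F \<subseteq> F"
proof -
  have "locally_finite (Poly_Mapping.lookup t ` Poly_Mapping.keys t)" using assms by simp
  then obtain S where S: "finite S" "Poly_Mapping.lookup t ` Poly_Mapping.keys t \<subseteq> span S"
    "\<forall>X. \<pi> X ` span S \<subseteq> span S" unfolding locally_finite_def by blast
  have inv: "\<pi> X v \<in> span S" if "v \<in> span S" for X v using S(3) that by blast
  \<comment> \<open>The degree is strictly below \<open>k\<close>, so that \<open>\<delta>\<close> maps \<open>G (k + 1)\<close> to \<open>G k\<close> also for \<open>k = 0\<close>.\<close>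
  define G where "G k = {s :: ('m \<times> 'n, 'v) vpoly. \<forall>\<mu>. Poly_Mapping.lookup s \<mu> \<in> span S
      \<and> (Poly_Mapping.lookup s \<mu> \<noteq> 0 \<longrightarrow> deg \<mu> < k)}" for k
  have sub: "T.subspace (G k)" for k
    unfolding G_def T.subspace_def
    by (auto simp: lookup_add lookup_tscale span_add span_scale span_zero) (metis add_0)
  have G_d: "d s \<in> G (Suc k)" if s: "s \<in> G k" for s k
  proof -
    have "Poly_Mapping.lookup (d s) \<nu> \<in> span S" for \<nu>
      unfolding lookup_d using s by (intro span_sum) (auto simp: G_def span_zero inv)
    moreover have "deg \<nu> < Suc k" if nz: "Poly_Mapping.lookup (d s) \<nu> \<noteq> 0" for \<nu>
    proof -
      obtain p where p: "Poly_Mapping.lookup \<nu> p \<noteq> 0" "\<pi> (dd p) (Poly_Mapping.lookup s (\<nu> - unit_exp p)) \<noteq> 0"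
        using nz unfolding lookup_d
        by (rule sum.not_neutral_contains_not_neutral) (simp split: if_splits)
      then have "Poly_Mapping.lookup s (\<nu> - unit_exp p) \<noteq> 0" by auto
      then have "deg (\<nu> - unit_exp p) < k" using s by (simp add: G_def)
      then show ?thesis using deg_minus_unit_exp[OF p(1)] by simp
    qed
    ultimately show ?thesis by (simp add: G_def)
  qed
  have G_\<delta>: "\<delta> s \<in> G k" if s: "s \<in> G (Suc k)" for s k
  proof -
    have "Poly_Mapping.lookup (\<delta> s) \<nu> \<in> span S" for \<nu>
      unfolding lookup_\<delta> using s by (intro span_sum span_scale inv) (simp add: G_def)
    moreover have "deg \<nu> < k" if nz: "Poly_Mapping.lookup (\<delta> s) \<nu> \<noteq> 0" for \<nu>
    proof -
      obtain p where "sc (of_nat (Suc (Poly_Mapping.lookup \<nu> p)))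
          (\<pi> (xx p) (Poly_Mapping.lookup s (\<nu> + unit_exp p))) \<noteq> 0"
        using nz unfolding lookup_\<delta> by (rule sum.not_neutral_contains_not_neutral)
      then have "Poly_Mapping.lookup s (\<nu> + unit_exp p) \<noteq> 0" by auto
      then have "deg (\<nu> + unit_exp p) < Suc k" using s unfolding G_def by blast
      then show ?thesis unfolding deg_add_unit_exp by simp
    qed
    ultimately show ?thesis by (simp add: G_def)
  qed
  define k where "k = Suc (\<Sum>\<mu>\<in>Poly_Mapping.keys t. deg \<mu>)"
  have "t \<in> G (Suc k)"
  proof -
    have "Poly_Mapping.lookup t \<mu> \<in> span S" for \<mu>
      using S(2) by (cases "\<mu> \<in> Poly_Mapping.keys t") (auto simp: in_keys_iff span_zero)
    moreover have "deg \<mu> < Suc k" if "Poly_Mapping.lookup t \<mu> \<noteq> 0" for \<mu>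
      using member_le_sum[of \<mu> "Poly_Mapping.keys t" deg] that by (simp add: in_keys_iff k_def)
    ultimately show ?thesis by (simp add: G_def)
  qed
  moreover have "(\<lambda>s. d (\<delta> s) + \<delta> (d s)) ` G (Suc k) \<subseteq> G (Suc k)"
    using G_d G_\<delta> sub by (auto intro!: T.subspace_add)
  moreover have "G (Suc k) \<subseteq> T.span ((\<lambda>(\<mu>, v). Poly_Mapping.single \<mu> v) ` ({\<mu>. deg \<mu> < Suc k} \<times> S))"
    (is "_ \<subseteq> T.span ?S")
  proof
    fix s assume s: "s \<in> G (Suc k)"
    have "Poly_Mapping.single \<mu> (Poly_Mapping.lookup s \<mu>) \<in> T.span ?S" if \<mu>: "\<mu> \<in> Poly_Mapping.keys s" for \<mu>
    proof -
      interpret single: Vector_Spaces.linear sc "tscale sc" "Poly_Mapping.single \<mu> :: 'v \<Rightarrow> ('m \<times> 'n, 'v) vpoly"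
        unfolding Vector_Spaces.linear_iff
        using vector_space_axioms T.vector_space_axioms
        by (auto intro!: poly_mapping_eqI simp: lookup_single when_def lookup_tscale single_add)
      have "Poly_Mapping.lookup s \<mu> \<in> span S" "deg \<mu> < Suc k"
        using s \<mu> by (auto simp: G_def in_keys_iff)
      then have "Poly_Mapping.single \<mu> (Poly_Mapping.lookup s \<mu>) \<in> T.span (Poly_Mapping.single \<mu> ` S)"
        unfolding single.span_image by blast
      moreover have "Poly_Mapping.single \<mu> ` S \<subseteq> ?S" using \<open>deg \<mu> < Suc k\<close> by auto
      ultimately show ?thesis using T.span_mono by blast
    qed
    then have "(\<Sum>\<mu>\<in>Poly_Mapping.keys s. Poly_Mapping.single \<mu> (Poly_Mapping.lookup s \<mu>)) \<in> T.span ?S"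
      by (rule T.span_sum)
    then show "s \<in> T.span ?S" by (simp flip: single_sum_keys)
  qed
  moreover have "finite ((\<lambda>(\<mu> :: ('m \<times> 'n) monom, v). Poly_Mapping.single \<mu> v) ` ({\<mu>. deg \<mu> < Suc k} \<times> S))"
    using S(1) finite_deg_less by blast
  ultimately show ?thesis using sub by blast
qed

section \<open>Equivariance\<close>

lemma tlinear_act_S: "tlinear (act_S sc \<pi> X)"
proof -
  note t = tlinear_op_tensor[OF vlinear_act[of X], of id] tlinear_op_tensor[OF vlinear_id, of "ad_S X"]
  show ?thesis
    unfolding act_S_def
    by (rule tlinearI) (simp_all add: tlinear_add[OF t(1)] tlinear_add[OF t(2)]
        tlinear_scale[OF t(1)] tlinear_scale[OF t(2)] T.scale_right_distrib)
qed

text \<open>\<open>X\<close> acts by \<open>\<pi>(X) \<otimes> 1 + 1 \<otimes> ad X\<close>, and operators on different factors commute.\<close>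

lemma act_S_commutator:
  assumes "vlinear a" "plinear b"
  shows "act_S sc \<pi> X (op_tensor sc a b t) - op_tensor sc a b (act_S sc \<pi> X t)
    = op_tensor sc (\<lambda>v. \<pi> X (a v) - a (\<pi> X v)) b t
      + op_tensor sc a (\<lambda>f. ad_S X (b f) - b (ad_S X f)) t"
proof -
  note simps = op_tensor_comp[OF _ _ _ _] vlinear_act vlinear_id plinear_id plinear_ad_S assms
  show ?thesis
    unfolding act_S_def tlinear_add[OF tlinear_op_tensor[OF assms(1)]]
    by (simp add: simps op_tensor_diff_left op_tensor_diff_right)
qed

lemma act_even_dd: "X \<in> g0 \<Longrightarrow> \<pi> X (\<pi> (dd i) v) - \<pi> (dd i) (\<pi> X v)
    = (\<Sum>q\<in>UNIV. sc (- ad_coeff X q i) (\<pi> (dd q) v))"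
  using act_even[OF _ dd_odd, of X i v] by (simp add: sbracket_even_dd act_sum flip: scale_minus_left)

lemma act_even_xx: "X \<in> g0 \<Longrightarrow> \<pi> X (\<pi> (xx i) v) - \<pi> (xx i) (\<pi> X v)
    = (\<Sum>q\<in>UNIV. sc (ad_coeff X i q) (\<pi> (xx q) v))"
  using act_even[OF _ xx_odd, of X i v] by (simp add: sbracket_even_xx act_sum)

lemma tscale_uminus: "tscale sc (- c) t = - tscale sc c t"
  by (rule T.scale_minus_left)

text \<open>In \<open>d = \<Sum> \<partial>\<^sub>i \<otimes> x\<^sub>i\<close> and \<open>\<delta> = \<Sum> x\<^sub>i \<otimes> \<partial>\<^sub>i\<close> the two factors run through dual bases, on which \<open>X\<close>
  acts by negative transposes, so that the two halves of the commutator cancel.\<close>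

lemma act_S_d: assumes "X \<in> g0" shows "act_S sc \<pi> X (d t) = d (act_S sc \<pi> X t)"
proof -
  interpret act: Vector_Spaces.linear "tscale sc" "tscale sc" "act_S sc \<pi> X" by (rule tlinear_act_S)
  have "act_S sc \<pi> X (d t) - d (act_S sc \<pi> X t)
    = (\<Sum>i\<in>UNIV. (\<Sum>q\<in>UNIV. - tscale sc (ad_coeff X q i) (op_tensor sc (\<pi> (dd q)) ((*) (var i)) t))
      + (\<Sum>q\<in>UNIV. tscale sc (ad_coeff X i q) (op_tensor sc (\<pi> (dd i)) ((*) (var q)) t)))"
    unfolding d_op_def act.sum sum_subtractf[symmetric] act_S_commutator[OF vlinear_act plinear_times]
      act_even_dd[OF assms] ad_S_var_times add_diff_cancel_left'
      op_tensor_sum_left op_tensor_scale_left op_tensor_sum_right op_tensor_scale_right tscale_uminus ..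
  also have "\<dots> = 0"
    unfolding sum.distrib sum_negf by (subst sum.swap) simp
  finally show ?thesis by simp
qed

lemma act_S_\<delta>: assumes "X \<in> g0" shows "act_S sc \<pi> X (\<delta> t) = \<delta> (act_S sc \<pi> X t)"
proof -
  interpret act: Vector_Spaces.linear "tscale sc" "tscale sc" "act_S sc \<pi> X" by (rule tlinear_act_S)
  have ad: "ad_S X (pderiv i f) - pderiv i (ad_S X f)
      = (\<Sum>p\<in>UNIV. pscale (- ad_coeff X p i) (pderiv p f))" for i f
  proof -
    have "pscale (- c) g = - pscale c g" for c and g :: "('m \<times> 'n) cpoly"
      by (rule poly_mapping_eqI) (simp add: lookup_pscale)
    then show ?thesis unfolding pderiv_ad_S by (simp add: sum_negf)
  qed
  have "act_S sc \<pi> X (\<delta> t) - \<delta> (act_S sc \<pi> X t)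
    = (\<Sum>i\<in>UNIV. (\<Sum>q\<in>UNIV. tscale sc (ad_coeff X i q) (op_tensor sc (\<pi> (xx q)) (pderiv i) t))
      + (\<Sum>q\<in>UNIV. - tscale sc (ad_coeff X q i) (op_tensor sc (\<pi> (xx i)) (pderiv q) t)))"
    unfolding delta_op_def act.sum sum_subtractf[symmetric] act_S_commutator[OF vlinear_act plinear_pderiv]
      act_even_xx[OF assms] ad
      op_tensor_sum_left op_tensor_scale_left op_tensor_sum_right op_tensor_scale_right tscale_uminus ..
  also have "\<dots> = 0"
    unfolding sum.distrib sum_negf by (subst sum.swap) simp
  finally show ?thesis by simp
qed

lemma hcomp_act_S: "hcomp i (act_S sc \<pi> X t) = act_S sc \<pi> X (hcomp i t)"
proof -
  have ad: "op_tensor sc id (ad_S X) t = (\<Sum>p\<in>UNIV. \<Sum>q\<in>UNIV. tscale sc (ad_coeff X p q)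
      (op_tensor sc id ((*) (var q)) (op_tensor sc id (pderiv p) t)))" for t
    unfolding ad_S_eq op_tensor_sum_right op_tensor_scale_right
      op_tensor_comp[OF vlinear_id vlinear_id plinear_times plinear_pderiv] by (simp add: id_def)
  have lookup_left: "Poly_Mapping.lookup (op_tensor sc (\<pi> X) id t) \<nu> = \<pi> X (Poly_Mapping.lookup t \<nu>)"
    for t :: "('m \<times> 'n, 'v) vpoly" and \<nu>
    unfolding lookup_op_tensor
    by (auto simp: monomial_def lookup_single when_def if_distrib[of "\<lambda>x. sc x _"] in_keys_iff cong: if_cong)
  have deg: "deg (\<nu> - unit_exp q + unit_exp p) = deg \<nu>" if "Poly_Mapping.lookup \<nu> q > 0"
    for \<nu> :: "('m \<times> 'n) monom" and p q
    using deg_minus_unit_exp[of \<nu> q] that unfolding deg_add_unit_exp by simp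
  show ?thesis
    unfolding act_S_def hcomp_add ad hcomp_sum hcomp_tscale
    by (intro arg_cong2[of _ _ _ _ "(+)"] sum.cong refl arg_cong[of _ _ "tscale sc _"] poly_mapping_eqI)
      (simp_all add: lookup_hcomp lookup_left lookup_op_tensor_var[OF vlinear_id]
        lookup_op_tensor_pderiv[OF vlinear_id] deg del: One_nat_def)
qed

lemma act_M_eq:
  assumes "X \<in> g0" shows "act_M sc \<pi> X t = act_S sc \<pi> X t + tscale sc (chi_minus_rho1 X) t"
proof -
  have "op_tensor sc id (alpha X) t
    = op_tensor sc id (ad_S X) t + tscale sc (chi_minus_rho1 X) (op_tensor sc id id t)"
    unfolding alpha_eq_ad_S[OF assms, abs_def] op_tensor_add_right op_tensor_scale_right
    by (simp add: id_def)
  then show ?thesis unfolding act_M_def act_S_def op_tensor_id by simp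
qed

end

section \<open>Isomorphisms of \<open>\<gg>\<^sub>0\<close>-modules\<close>

text \<open>The conditions in \<^const>\<open>g0_isomorphic\<close> on a given map: composing isomorphisms and twisting them by
  a character requires the map itself.\<close>

definition lmod_iso ::
  "('a \<Rightarrow> 'b) \<Rightarrow> (('m::finite, 'n::finite) gl, 'a) lmod \<Rightarrow> (('m, 'n) gl, 'b) lmod \<Rightarrow> bool" where
  "lmod_iso \<phi> M N \<longleftrightarrow> bij_betw \<phi> (lcarrier M) (lcarrier N)
     \<and> (\<forall>a\<in>lcarrier M. \<forall>b\<in>lcarrier M. \<phi> (ladd M a b) = ladd N (\<phi> a) (\<phi> b))
     \<and> (\<forall>c. \<forall>a\<in>lcarrier M. \<phi> (lsmult M c a) = lsmult N c (\<phi> a))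
     \<and> (\<forall>X\<in>g0. \<forall>a\<in>lcarrier M. \<phi> (lact M X a) = lact N X (\<phi> a))"

definition lmod_closed :: "(('m::finite, 'n::finite) gl, 'a) lmod \<Rightarrow> bool" where
  "lmod_closed M \<longleftrightarrow>
     (\<forall>a\<in>lcarrier M. \<forall>b\<in>lcarrier M. ladd M a b \<in> lcarrier M)
     \<and> (\<forall>c. \<forall>a\<in>lcarrier M. lsmult M c a \<in> lcarrier M)
     \<and> (\<forall>X\<in>g0. \<forall>a\<in>lcarrier M. lact M X a \<in> lcarrier M)"

text \<open>The isomorphism is \<open>\<psi> \<circ> \<phi>\<^sup>-\<^sup>1\<close>. The operations of \<open>K\<close> must not leave its carrier, since \<open>\<phi>\<close> and
  \<open>\<psi>\<close> are only controlled there.\<close>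

lemma g0_isomorphic_if_common:
  assumes \<phi>: "lmod_iso \<phi> K M" and \<psi>: "lmod_iso \<psi> K N" and closed: "lmod_closed K"
  shows "g0_isomorphic M N"
proof -
  let ?inv = "inv_into (lcarrier K) \<phi>"
  have bij: "bij_betw \<phi> (lcarrier K) (lcarrier M)" using \<phi> by (simp add: lmod_iso_def)
  have img: "\<phi> ` lcarrier K = lcarrier M" using bij by (simp add: bij_betw_def)
  have inv: "?inv (\<phi> a) = a" if "a \<in> lcarrier K" for a
    using bij that by (simp add: bij_betw_def)
  have "bij_betw (\<psi> \<circ> ?inv) (lcarrier M) (lcarrier N)"
    using bij_betw_trans[OF bij_betw_inv_into[OF bij]] \<psi> by (auto simp: lmod_iso_def)
  moreover have "(\<psi> \<circ> ?inv) (ladd M (\<phi> a) (\<phi> b)) = ladd N ((\<psi> \<circ> ?inv) (\<phi> a)) ((\<psi> \<circ> ?inv) (\<phi> b))"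
    if "a \<in> lcarrier K" "b \<in> lcarrier K" for a b
  proof -
    have "ladd M (\<phi> a) (\<phi> b) = \<phi> (ladd K a b)" "ladd K a b \<in> lcarrier K"
      using \<phi> closed that by (simp_all add: lmod_iso_def lmod_closed_def)
    then show ?thesis using \<psi> that by (simp add: inv lmod_iso_def)
  qed
  moreover have "(\<psi> \<circ> ?inv) (lsmult M c (\<phi> a)) = lsmult N c ((\<psi> \<circ> ?inv) (\<phi> a))"
    if "a \<in> lcarrier K" for a c
  proof -
    have "lsmult M c (\<phi> a) = \<phi> (lsmult K c a)" "lsmult K c a \<in> lcarrier K"
      using \<phi> closed that by (simp_all add: lmod_iso_def lmod_closed_def)
    then show ?thesis using \<psi> that by (simp add: inv lmod_iso_def)
  qed
  moreover have "(\<psi> \<circ> ?inv) (lact M X (\<phi> a)) = lact N X ((\<psi> \<circ> ?inv) (\<phi> a))"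
    if "a \<in> lcarrier K" "X \<in> g0" for a X
  proof -
    have "lact M X (\<phi> a) = \<phi> (lact K X a)" "lact K X a \<in> lcarrier K"
      using \<phi> closed that by (simp_all add: lmod_iso_def lmod_closed_def)
    then show ?thesis using \<psi> that by (simp add: inv lmod_iso_def)
  qed
  ultimately show ?thesis
    unfolding g0_isomorphic_def img[symmetric] by (intro exI[of _ "\<psi> \<circ> ?inv"]) blast
qed

lemma lmod_iso_tensor_char:
  assumes "lmod_iso \<phi> M N" "lmod_closed M"
  shows "lmod_iso \<phi> (tensor_char M \<xi>) (tensor_char N \<xi>)"
  using assms unfolding lmod_iso_def lmod_closed_def tensor_char_def by simp

lemma lmod_closed_tensor_char: "lmod_closed M \<Longrightarrow> lmod_closed (tensor_char M \<xi>)"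
  unfolding lmod_closed_def tensor_char_def by simp

lemma elt_set_plus_eq_iff:
  assumes "0 \<in> L" "\<And>a b. a \<in> L \<Longrightarrow> b \<in> L \<Longrightarrow> a + b \<in> L" "\<And>a. a \<in> L \<Longrightarrow> - a \<in> L"
  shows "a +o L = b +o L \<longleftrightarrow> a - b \<in> (L :: 'a::ab_group_add set)"
proof
  assume "a +o L = b +o L"
  moreover have "a \<in> a +o L" using assms(1) by (auto simp: elt_set_plus_def)
  ultimately show "a - b \<in> L" by (auto simp: elt_set_plus_def)
next
  assume ab: "a - b \<in> L"
  show "a +o L = b +o L"
  proof (intro equalityI subsetI)
    fix x assume "x \<in> a +o L"
    then obtain l where l: "l \<in> L" "x = a + l" by (auto simp: elt_set_plus_def)
    then have "x = b + ((a - b) + l)" by simp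
    with assms(2)[OF ab l(1)] show "x \<in> b +o L" unfolding elt_set_plus_def by blast
  next
    fix x assume "x \<in> b +o L"
    then obtain l where l: "l \<in> L" "x = b + l" by (auto simp: elt_set_plus_def)
    then have "x = a + (- (a - b) + l)" by simp
    with assms(2)[OF assms(3)[OF ab] l(1)] show "x \<in> a +o L" unfolding elt_set_plus_def by blast
  qed
qed

text \<open>The operations of \<^const>\<open>quotmod\<close> are given by images of cosets; this computes them on
  representatives.\<close>

lemma image_elt_set_plus:
  assumes add: "\<And>a b. f (a + b) = f a + f b"
    and f: "f ` L \<subseteq> L" and L: "0 \<in> L" "\<And>a b. a \<in> L \<Longrightarrow> b \<in> L \<Longrightarrow> a + b \<in> L"
  shows "f ` (a +o L) + L = f a +o (L :: 'a::ab_group_add set)"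
proof (intro equalityI subsetI)
  fix x assume "x \<in> f ` (a +o L) + L"
  then obtain l l' where l: "l \<in> L" "l' \<in> L" "x = f (a + l) + l'"
    by (auto simp: set_plus_def elt_set_plus_def)
  then have "x = f a + (f l + l')" by (simp add: add add.assoc)
  moreover have "f l + l' \<in> L" using l f L by blast
  ultimately show "x \<in> f a +o L" by (auto simp: elt_set_plus_def)
next
  fix x assume "x \<in> f a +o L"
  then obtain l where l: "l \<in> L" "x = f a + l" by (auto simp: elt_set_plus_def)
  have "a + 0 \<in> a +o L" using L(1) by (auto simp: elt_set_plus_def)
  then show "x \<in> f ` (a +o L) + L" using l by (auto simp: set_plus_def)
qed

section \<open>Harmonic representatives\<close>

locale unitary_gl_action = gl_action sc \<pi>
  for sc :: "complex \<Rightarrow> 'v::ab_group_add \<Rightarrow> 'v"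
    and \<pi> :: "('m::finite, 'n::finite) gl \<Rightarrow> 'v \<Rightarrow> 'v" +
  fixes H :: "'v \<Rightarrow> 'v \<Rightarrow> complex"
  assumes form: "pos_def_hermitian sc H"
    and contravariant: "H (\<pi> X v) w = H v (\<pi> (omega X) w)"
    and fin: "finite A \<Longrightarrow> locally_finite A"
begin

lemma act_S_zero: "act_S sc \<pi> X 0 = 0"
proof -
  interpret act: Vector_Spaces.linear "tscale sc" "tscale sc" "act_S sc \<pi> X" by (rule tlinear_act_S)
  show ?thesis by (rule act.zero)
qed

lemma omega_dd: "omega (dd p) = xx p"
  by (auto simp: omega_def dd_def xx_def E_nth vec_eq_iff)

text \<open>Adjointness on \<open>V\<close>, where \<open>\<omega>\<close> exchanges \<open>\<partial>\<^sub>p\<close> and \<open>x\<^sub>p\<close>, is combined with adjointness on polynomials.\<close>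

lemma d_adjoint: "fischer H (d s) t = fischer H s (\<delta> t)"
proof -
  have add: "fischer H (u + v) w = fischer H u w + fischer H v w"
    and cnj: "fischer H v w = cnj (fischer H w v)" for u v w :: "('m \<times> 'n, 'v) vpoly"
    using fischer_pos_def[OF form] unfolding pos_def_hermitian_def by blast+
  have "fischer H 0 w = 0" for w :: "('m \<times> 'n, 'v) vpoly" by (simp add: fischer_def)
  then have sum_left: "fischer H (\<Sum>i\<in>I. f i) w = (\<Sum>i\<in>I. fischer H (f i) w)"
    for f and I :: "('m \<times> 'n) set" and w :: "('m \<times> 'n, 'v) vpoly"
    by (induction I rule: infinite_finite_induct) (simp_all add: add)
  have sum_right: "fischer H w (\<Sum>i\<in>I. f i) = (\<Sum>i\<in>I. fischer H w (f i))"
    for f and I :: "('m \<times> 'n) set" and w :: "('m \<times> 'n, 'v) vpoly"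
    unfolding cnj[of w] sum_left cnj_sum ..
  have "H (\<pi> (dd p) v) w = H v (\<pi> (xx p) w)" for p v w
    unfolding contravariant omega_dd ..
  then show ?thesis
    unfolding d_op_def delta_op_def sum_left sum_right
    by (intro sum.cong refl fischer_adjoint[OF form vlinear_act vlinear_act])
qed

sublocale hodge: adjoint_differentials "tscale sc" "fischer H" d \<delta>
  by unfold_locales
    (rule fischer_pos_def[OF form] tlinear_add[OF tlinear_d] tlinear_scale[OF tlinear_d]
      tlinear_add[OF tlinear_\<delta>] tlinear_scale[OF tlinear_\<delta>] d_adjoint d_squared \<delta>_squared
      laplacian_locally_finite[OF fin] | assumption)+

lemma ker_D: "ker (D_op sc \<pi>) = hodge.harmonic"
  unfolding hodge.ker_dirac[symmetric] ker_def D_op_eq by simp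

lemma ker_range_D: "ker (D_op sc \<pi>) \<inter> range (D_op sc \<pi>) = {0}"
proof -
  have "D_op sc \<pi> t = d (tscale sc 2 t) - \<delta> (tscale sc 2 t)" for t
    by (simp add: D_op_eq hodge.d.scale hodge.\<delta>.scale T.scale_right_diff_distrib)
  then have "range (D_op sc \<pi>) \<subseteq> range (\<lambda>t. d t - \<delta> t)" by auto
  moreover have "0 \<in> ker (D_op sc \<pi>)" "0 = D_op sc \<pi> 0" by (simp_all add: ker_def D_op_eq)
  ultimately show ?thesis using hodge.range_dirac_harmonic unfolding ker_D by blast
qed

lemma hcomp_harmonic: "t \<in> hodge.harmonic \<Longrightarrow> hcomp i t \<in> hodge.harmonic"
proof -
  assume t: "t \<in> hodge.harmonic"
  then have "d t = 0" "\<delta> t = 0" by (simp_all add: hodge.harmonic_def ker_def)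
  then have "d (hcomp i t) = 0" by (simp add: hcomp_zero flip: hcomp_d_Suc)
  moreover have "\<delta> (hcomp i t) = 0"
    using \<open>\<delta> t = 0\<close> by (cases i) (simp_all add: \<delta>_hcomp_0 hcomp_zero flip: hcomp_\<delta>)
  ultimately show "hcomp i t \<in> hodge.harmonic" by (simp add: hodge.harmonic_def ker_def)
qed

abbreviation harmonic_mod where
  "harmonic_mod \<equiv> submod (tscale sc) (act_S sc \<pi>) hodge.harmonic"

lemma harmonic_mod_closed: "lmod_closed harmonic_mod"
proof -
  have "act_S sc \<pi> X t \<in> hodge.harmonic" if "X \<in> g0" "t \<in> hodge.harmonic" for X t
    using that
    by (simp add: hodge.harmonic_def ker_def act_S_zero flip: act_S_d act_S_\<delta>)
  then show ?thesis
    using hodge.subspaces(1) by (simp add: lmod_closed_def submod_def T.subspace_add T.subspace_scale)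
qed

text \<open>\<open>Z i\<close> and \<open>L i\<close> are the cycles and boundaries of degree \<open>i\<close>. The map from harmonic elements to
  the classes of their homogeneous components is one-to-one because a harmonic boundary
  vanishes, and onto because harmonic representatives of finitely many classes can be added up.\<close>

lemma harmonic_representatives:
  assumes L: "\<And>i. T.subspace (L i)" "\<And>i X. X \<in> g0 \<Longrightarrow> act_S sc \<pi> X ` L i \<subseteq> L i"
    and cycle: "\<And>i t. t \<in> hodge.harmonic \<Longrightarrow> t \<in> vhom i \<Longrightarrow> t \<in> Z i"
    and repr: "\<And>i t. t \<in> Z i \<Longrightarrow> \<exists>k\<in>hodge.harmonic \<inter> vhom i. t - k \<in> L i"
    and triv: "\<And>i t. t \<in> hodge.harmonic \<Longrightarrow> t \<in> L i \<Longrightarrow> t = 0"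
  shows "lmod_iso (\<lambda>t i. hcomp i t +o L i) harmonic_mod
    (dsum_mod (\<lambda>i. quotmod (tscale sc) (act_S sc \<pi>) (Z i) (L i)))"
proof -
  let ?\<phi> = "\<lambda>t i. hcomp i t +o L i"
  let ?M = "dsum_mod (\<lambda>i. quotmod (tscale sc) (act_S sc \<pi>) (Z i) (L i))"
  have L0: "0 \<in> L i" and L_add: "a \<in> L i \<Longrightarrow> b \<in> L i \<Longrightarrow> a + b \<in> L i"
    and L_neg: "a \<in> L i \<Longrightarrow> - a \<in> L i" and L_scale: "a \<in> L i \<Longrightarrow> tscale sc c a \<in> L i" for i a b c
    using L(1) by (simp_all add: T.subspace_0 T.subspace_add T.subspace_neg T.subspace_scale)
  have coset_eq: "a +o L i = b +o L i \<longleftrightarrow> a - b \<in> L i" for a b i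
    by (rule elt_set_plus_eq_iff[OF L0 L_add L_neg])
  have coset_0: "a +o L i = L i \<longleftrightarrow> a \<in> L i" for a i
    using coset_eq[of a i 0] by simp
  have LL: "L i + L i = L i" for i
    using L0 L_add by (auto simp: set_plus_def) (metis add_0)
  have "?\<phi> t \<in> lcarrier ?M" if t: "t \<in> hodge.harmonic" for t
  proof -
    have "hcomp i t +o L i \<in> (\<lambda>a. a +o L i) ` Z i" for i
      using cycle[OF hcomp_harmonic[OF t] hcomp_in_vhom] by blast
    moreover have "finite {i. hcomp i t +o L i \<noteq> L i}"
      by (rule finite_subset[OF _ finite_hcomp[of t]]) auto
    ultimately show ?thesis by (simp add: dsum_mod_def quotmod_def)
  qed
  moreover have "inj_on ?\<phi> hodge.harmonic"
  proof (rule inj_onI)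
    fix s t assume st: "s \<in> hodge.harmonic" "t \<in> hodge.harmonic" and eq: "?\<phi> s = ?\<phi> t"
    have "hcomp i s = hcomp i t" for i
    proof -
      have "hcomp i s - hcomp i t \<in> L i" using fun_cong[OF eq, of i] coset_eq by simp
      moreover have "hcomp i s - hcomp i t \<in> hodge.harmonic"
        using hcomp_harmonic st hodge.subspaces(1) by (simp add: T.subspace_diff)
      ultimately show ?thesis using triv[of "hcomp i s - hcomp i t" i] by simp
    qed
    then show "s = t" by (rule hcomp_eqI)
  qed
  moreover have "f \<in> ?\<phi> ` hodge.harmonic" if "f \<in> lcarrier ?M" for f
  proof -
    have f: "f i \<in> (\<lambda>a. a +o L i) ` Z i" "finite {i. f i \<noteq> L i}" for i
      using that by (simp_all add: dsum_mod_def quotmod_def)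
    have "\<exists>k. k \<in> hodge.harmonic \<inter> vhom i \<and> f i = k +o L i" for i
    proof -
      obtain a where a: "a \<in> Z i" "f i = a +o L i" using f(1) by blast
      obtain k where "k \<in> hodge.harmonic \<inter> vhom i" "a - k \<in> L i" using repr[OF a(1)] by blast
      then show ?thesis using a(2) coset_eq by blast
    qed
    then obtain k where k: "\<And>i. k i \<in> hodge.harmonic" "\<And>i. k i \<in> vhom i" "\<And>i. f i = k i +o L i"
      by (metis Int_iff)
    \<comment> \<open>Classes outside \<open>?J\<close> vanish, and the components there of the finite sum of representatives are \<open>0\<close>.\<close>
    let ?J = "{i. f i \<noteq> L i}"
    have "hcomp i (\<Sum>j\<in>?J. k j) +o L i = f i" for i
    proof -
      have "hcomp i (\<Sum>j\<in>?J. k j) = (\<Sum>j\<in>?J. if j = i then k i else 0)"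
        unfolding hcomp_sum by (rule sum.cong) (auto simp: hcomp_vhom[OF k(2)])
      then show ?thesis using f(2) k(3) by simp
    qed
    then have "f = ?\<phi> (\<Sum>j\<in>?J. k j)" by (intro ext) simp
    moreover have "(\<Sum>j\<in>?J. k j) \<in> hodge.harmonic"
      by (rule T.subspace_sum[OF hodge.subspaces(1) k(1)])
    ultimately show ?thesis by blast
  qed
  ultimately have "bij_betw ?\<phi> (lcarrier harmonic_mod) (lcarrier ?M)"
    unfolding bij_betw_def submod_def by auto
  moreover have "?\<phi> (s + t) = ladd ?M (?\<phi> s) (?\<phi> t)" for s t
    unfolding dsum_mod_def quotmod_def by (simp add: hcomp_add set_plus_rearrange LL)
  moreover have "?\<phi> (tscale sc c t) = lsmult ?M c (?\<phi> t)" for c t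
    unfolding dsum_mod_def quotmod_def
    by (simp add: hcomp_tscale image_elt_set_plus[of "tscale sc c", OF T.scale_right_distrib _ L0 L_add]
        L_scale image_subsetI)
  moreover have "?\<phi> (act_S sc \<pi> X t) = lact ?M X (?\<phi> t)" if "X \<in> g0" for X t
    unfolding dsum_mod_def quotmod_def
    by (simp add: hcomp_act_S image_elt_set_plus[of "act_S sc \<pi> X",
          OF tlinear_add[OF tlinear_act_S] L(2)[OF that] L0 L_add])
  ultimately show ?thesis unfolding lmod_iso_def by (simp add: submod_def)
qed

lemma tlinear_subspace_image: "tlinear f \<Longrightarrow> T.subspace W \<Longrightarrow> T.subspace (f ` W)"
proof -
  assume f: "tlinear f" and W: "T.subspace W"
  interpret f: Vector_Spaces.linear "tscale sc" "tscale sc" f by (rule f)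
  show "T.subspace (f ` W)" using W by (rule f.subspace_image)
qed

lemma act_S_vhom: "t \<in> vhom i \<Longrightarrow> act_S sc \<pi> X t \<in> vhom i"
  using hcomp_in_vhom[of i "act_S sc \<pi> X t"] by (simp add: hcomp_act_S hcomp_vhom)

lemma harmonic_iso_cohomology:
  "lmod_iso (\<lambda>t i. hcomp i t +o (case i of 0 \<Rightarrow> {0} | Suc j \<Rightarrow> d ` vhom j)) harmonic_mod
    (dsum_mod (cohomology_plus sc \<pi>))"
proof -
  let ?L = "\<lambda>i. case i of 0 \<Rightarrow> {0} | Suc j \<Rightarrow> d ` vhom j"
  have "lmod_iso (\<lambda>t i. hcomp i t +o ?L i) harmonic_mod
    (dsum_mod (\<lambda>i. quotmod (tscale sc) (act_S sc \<pi>) (ker d \<inter> vhom i) (?L i)))"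
  proof (rule harmonic_representatives)
    fix i
    show "T.subspace (?L i)"
      using tlinear_subspace_image[OF tlinear_d subspace_vhom] by (cases i) simp_all
    show "act_S sc \<pi> X ` ?L i \<subseteq> ?L i" if "X \<in> g0" for X
      using that act_S_vhom by (cases i) (auto simp: act_S_d act_S_zero)
    fix t
    show "t \<in> ker d \<inter> vhom i" if "t \<in> hodge.harmonic" "t \<in> vhom i"
      using that by (simp add: hodge.harmonic_def)
    show "\<exists>k\<in>hodge.harmonic \<inter> vhom i. t - k \<in> ?L i" if t: "t \<in> ker d \<inter> vhom i"
    proof -
      obtain a u where au: "t = a + d u" "a \<in> hodge.harmonic"
        using t hodge.ker_d_decomposition by blast
      have "t = hcomp i a + hcomp i (d u)"
        using t au(1) hcomp_vhom[of t i i] by (simp add: hcomp_add)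
      moreover have "hcomp i (d u) \<in> ?L i"
        by (cases i) (simp_all add: hcomp_d_0 hcomp_d_Suc hcomp_in_vhom)
      ultimately show ?thesis
        using hcomp_harmonic[OF au(2)] hcomp_in_vhom by (intro bexI[of _ "hcomp i a"]) auto
    qed
    show "t = 0" if "t \<in> hodge.harmonic" "t \<in> ?L i"
      using that hodge.harmonic_exact(1)[of t] by (cases i) auto
  qed
  then show ?thesis by (simp add: cohomology_plus_def[abs_def])
qed

lemma harmonic_iso_homology:
  "lmod_iso (\<lambda>t i. hcomp i t +o \<delta> ` vhom (Suc i)) harmonic_mod (dsum_mod (homology_minus sc \<pi>))"
proof -
  have "lmod_iso (\<lambda>t i. hcomp i t +o \<delta> ` vhom (Suc i)) harmonic_mod
    (dsum_mod (\<lambda>i. quotmod (tscale sc) (act_S sc \<pi>) (ker \<delta> \<inter> vhom i) (\<delta> ` vhom (Suc i))))"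
  proof (rule harmonic_representatives)
    fix i
    show "T.subspace (\<delta> ` vhom (Suc i))"
      by (rule tlinear_subspace_image[OF tlinear_\<delta> subspace_vhom])
    show "act_S sc \<pi> X ` \<delta> ` vhom (Suc i) \<subseteq> \<delta> ` vhom (Suc i)" if "X \<in> g0" for X
      using that act_S_vhom by (auto simp: act_S_\<delta>)
    fix t
    show "t \<in> ker \<delta> \<inter> vhom i" if "t \<in> hodge.harmonic" "t \<in> vhom i"
      using that by (simp add: hodge.harmonic_def)
    show "\<exists>k\<in>hodge.harmonic \<inter> vhom i. t - k \<in> \<delta> ` vhom (Suc i)" if t: "t \<in> ker \<delta> \<inter> vhom i"
    proof -
      obtain a w where aw: "t = a + \<delta> w" "a \<in> hodge.harmonic"
        using t hodge.ker_\<delta>_decomposition by blast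
      have "t = hcomp i a + \<delta> (hcomp (Suc i) w)"
        using t aw(1) hcomp_vhom[of t i i] by (simp add: hcomp_add hcomp_\<delta>)
      then show ?thesis
        using hcomp_harmonic[OF aw(2)] hcomp_in_vhom by (intro bexI[of _ "hcomp i a"]) auto
    qed
    show "t = 0" if "t \<in> hodge.harmonic" "t \<in> \<delta> ` vhom (Suc i)"
      using that hodge.harmonic_exact(2)[of t] by auto
  qed
  then show ?thesis by (simp add: homology_minus_def[abs_def])
qed

text \<open>Since \<open>Ker D\<close> meets \<open>Im D\<close> only in \<open>0\<close>, the cosets are singletons. The character enters because
  \<open>\<gg>\<^sub>0\<close> acts on \<open>H\<^sub>D(V)\<close> through \<open>\<alpha>\<close> but on the harmonic elements through the adjoint action.\<close>

lemma harmonic_iso_dirac_cohomology: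
  "lmod_iso (\<lambda>t. {t}) (tensor_char harmonic_mod chi_minus_rho1) (dirac_cohomology sc \<pi>)"
proof -
  have "t +o {0} = {t}" for t :: "('m \<times> 'n, 'v) vpoly" by (auto simp: elt_set_plus_def)
  moreover have "{s} + {t} = {s + t}" for s t :: "('m \<times> 'n, 'v) vpoly"
    by (auto simp: set_plus_def)
  ultimately show ?thesis
    unfolding dirac_cohomology_def ker_D ker_range_D[unfolded ker_D] lmod_iso_def tensor_char_def submod_def quotmod_def
    by (auto simp: bij_betw_def inj_on_def act_M_eq)
qed

theorem dirac_cohomology_isomorphisms:
  "g0_isomorphic (dirac_cohomology sc \<pi>) (tensor_char (dsum_mod (cohomology_plus sc \<pi>)) chi_minus_rho1)"
  "g0_isomorphic (tensor_char (dsum_mod (cohomology_plus sc \<pi>)) chi_minus_rho1)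
     (tensor_char (dsum_mod (homology_minus sc \<pi>)) chi_minus_rho1)"
  using g0_isomorphic_if_common[OF harmonic_iso_dirac_cohomology
      lmod_iso_tensor_char[OF harmonic_iso_cohomology harmonic_mod_closed]
      lmod_closed_tensor_char[OF harmonic_mod_closed]]
    g0_isomorphic_if_common[OF lmod_iso_tensor_char[OF harmonic_iso_cohomology harmonic_mod_closed]
      lmod_iso_tensor_char[OF harmonic_iso_homology harmonic_mod_closed]
      lmod_closed_tensor_char[OF harmonic_mod_closed]]
  by blast+

end

theorem theorem12:
  fixes sc :: "complex \<Rightarrow> 'v::ab_group_add \<Rightarrow> 'v"
    and Vgr :: "bit \<Rightarrow> 'v set"
    and \<pi> :: "('m::finite, 'n::finite) gl \<Rightarrow> 'v \<Rightarrow> 'v"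
  assumes "g_g0_module sc Vgr \<pi>"
    and "irreducible_module sc Vgr \<pi>"
    and "unitary_module sc \<pi>"
  shows "is_direct_sum_list
           [ker (D_op sc \<pi>), range (d_op sc \<pi>), range (delta_op sc \<pi>)] UNIV
       \<and> is_direct_sum_list [ker (D_op sc \<pi>), range (d_op sc \<pi>)] (ker (d_op sc \<pi>))
       \<and> is_direct_sum_list [ker (D_op sc \<pi>), range (delta_op sc \<pi>)] (ker (delta_op sc \<pi>))
       \<and> g0_isomorphic (dirac_cohomology sc \<pi>)
           (tensor_char (dsum_mod (cohomology_plus sc \<pi>)) chi_minus_rho1)
       \<and> g0_isomorphic (tensor_char (dsum_mod (cohomology_plus sc \<pi>)) chi_minus_rho1)
           (tensor_char (dsum_mod (homology_minus sc \<pi>)) chi_minus_rho1)"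
proof -
  have module: "gl_module sc Vgr \<pi>" using assms(1) by (simp add: g_g0_module_def)
  interpret gl_action sc \<pi>
    by (intro gl_action.intro complex_vector_space.intro gl_action_axioms.intro)
      (use module in \<open>simp_all add: gl_module_def\<close>)
  obtain H where H: "pos_def_hermitian sc H" "\<And>X v w. H (\<pi> X v) w = H v (\<pi> (omega X) w)"
    using assms(3) unfolding unitary_module_def by blast
  obtain \<W> :: "'v set set" where \<W>: "is_direct_sum \<W> (\<lambda>W. W) UNIV"
    "\<forall>W\<in>\<W>. g0_simple sc \<pi> W \<and> (\<exists>S. finite S \<and> span S = W)"
    using assms(1) unfolding g_g0_module_def by blast
  have "locally_finite A" if "finite A" for A
    using locally_finite_direct_sum[OF \<W>(1) _ that] \<W>(2) unfolding g0_simple_def by blast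
  then interpret unitary_gl_action sc \<pi> H by unfold_locales (use H in blast)+
  show ?thesis
    using hodge.direct_sums dirac_cohomology_isomorphisms unfolding ker_D by blast
qed

end
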